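(* Let $H_\kappa=-\Delta+Q_r+\kappa Q_t$ be as in the context and suppose Assumptions 1 hold. For every $E_0\in\mathbb R$ there exist an open interval $I\ni E_0$ and constants $s\in(0,1)$, $\epsilon_0>0$, $\kappa_0>0$, $C<\infty$, $\ell>1$ such that for all $\kappa\in[0,\kappa_0]$ and all $n\ge0$, $$\sup_{E\in I}\ \sup_{0<\epsilon<\epsilon_0}\ \mathbb E\big[\|P_0(H_\kappa-E-i\epsilon)^{-1}P_n\|^s\big]\le C\,\ell^{-n}.$$
   Context: Let $\mathbb B$ be the rooted binary tree: the root $0$ has two neighbours and every other vertex has three neighbours. $d(x,y)$ is the graph distance and $S_n=\{x\in\mathbb B: d(0,x)=n\}$. Every vertex $y$ has exactly two forward neighbours (children) in $S_{d(0,y)+1}$; one of them is labelled $c=0$ and the other $c=1$, and $c(x)$ denotes the label of $x\neq 0$. $\Delta$ is the adjacency operator, $(\Delta\psi)(x)=\sum_{y:d(x,y)=1}\psi(y)$. For $\kappa\ge 0$ put $H_\kappa=-\Delta+Q_r+\kappa Q_t$, where: $Q_r(x)=q_n$ for $x\in S_n$, with $q_0,q_1,\dots$ independent, $q_0\sim\nu_0$, $q_n\sim\nu$ for $n\ge1$; $Q_t(0)=0$ and $Q_t(x)=p_{n,c(x)}$ for $x\in S_n$, $n\ge1$, where the pairs $(p_{n,0},p_{n,1})$, $n\ge1$, are i.i.d. with joint distribution $\sigma$ and independent of $Q_r$. Assumptions 1: $\nu_0,\nu$ have bounded densities (also denoted $\nu_0,\nu$) supported in $[-K,K]$, $K<\infty$,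 and $\sigma$ is supported in $[-1,1]^2$. For $B\subseteq\mathbb B$, $P_B=\sum_{x\in B}|x\rangle\langle x|$ is the orthogonal projection onto $\ell^2(B)$ and $P_n=P_{S_n}$. $\mathbb E$ is expectation over the random potentials. *)

theory Defs
  imports "HOL-Probability.Probability"
begin

text \<open>Vertices of the rooted binary tree: finite bool lists (path from the root).
  The root is [], the two children of x are x @ [False] (label c = 0) and
  x @ [True] (label c = 1); the parent of x \<noteq> [] is butlast x.
  Hence d(0,x) = length x and S_n = {x. length x = n}.\<close>

type_synonym vertex = "bool list"

definition sphere :: "nat \<Rightarrow> vertex set" where
  "sphere n = {x. length x = n}"

definition adj :: "(vertex \<Rightarrow> complex) \<Rightarrow> vertex \<Rightarrow> complex" where
  "adj \<psi> x = \<psi> (x @ [False]) + \<psi> (x @ [True]) + (if x = [] then 0 else \<psi> (butlast x))"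

definition Qr :: "(nat \<Rightarrow> real) \<Rightarrow> vertex \<Rightarrow> real" where
  "Qr q x = q (length x)"

definition Qt :: "(nat \<Rightarrow> real \<times> real) \<Rightarrow> vertex \<Rightarrow> real" where
  "Qt p x = (if x = [] then 0 else if last x then snd (p (length x)) else fst (p (length x)))"

definition Hop :: "(nat \<Rightarrow> real) \<Rightarrow> (nat \<Rightarrow> real \<times> real) \<Rightarrow> real \<Rightarrow>
    (vertex \<Rightarrow> complex) \<Rightarrow> vertex \<Rightarrow> complex" where
  "Hop q p \<kappa> \<psi> x = - adj \<psi> x + complex_of_real (Qr q x + \<kappa> * Qt p x) * \<psi> x"

definition l2 :: "(vertex \<Rightarrow> complex) \<Rightarrow> bool" where
  "l2 f \<longleftrightarrow> (\<lambda>x. (cmod (f x))\<^sup>2) summable_on UNIV"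

definition l2norm :: "(vertex \<Rightarrow> complex) \<Rightarrow> real" where
  "l2norm f = sqrt (\<Sum>\<^sub>\<infinity>x. (cmod (f x))\<^sup>2)"

definition resolvent :: "(nat \<Rightarrow> real) \<Rightarrow> (nat \<Rightarrow> real \<times> real) \<Rightarrow> real \<Rightarrow> complex \<Rightarrow>
    (vertex \<Rightarrow> complex) \<Rightarrow> vertex \<Rightarrow> complex" where
  "resolvent q p \<kappa> z f = (THE \<psi>. l2 \<psi> \<and> (\<forall>x. Hop q p \<kappa> \<psi> x - z * \<psi> x = f x))"

definition proj :: "vertex set \<Rightarrow> (vertex \<Rightarrow> complex) \<Rightarrow> vertex \<Rightarrow> complex" where
  "proj B f x = (if x \<in> B then f x else 0)"

definition green_norm :: "(nat \<Rightarrow> real) \<Rightarrow> (nat \<Rightarrow> real \<times> real) \<Rightarrow> real \<Rightarrow> complex \<Rightarrow> nat \<Rightarrow> real" where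
  "green_norm q p \<kappa> z n =
     Sup {l2norm (proj (sphere 0) (resolvent q p \<kappa> z (proj (sphere n) f))) | f. l2 f \<and> l2norm f \<le> 1}"

text \<open>Probability space of the random potentials: q_n independent (q_0 ~ nu0, q_n ~ nu),
  (p_{n,0}, p_{n,1}) i.i.d. ~ sig, independent of q. (The coordinate p 0 is unused.)\<close>
definition pot_space :: "real measure \<Rightarrow> real measure \<Rightarrow> (real \<times> real) measure \<Rightarrow>
    ((nat \<Rightarrow> real) \<times> (nat \<Rightarrow> real \<times> real)) measure" where
  "pot_space nu0 nu sig =
     (\<Pi>\<^sub>M n\<in>UNIV. (if n = 0 then nu0 else nu)) \<Otimes>\<^sub>M (\<Pi>\<^sub>M n\<in>UNIV. sig)"

end

theory Submission
  imports Defs "HOL-Complex_Analysis.Great_Picard"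
begin

text \<open>On the sphere of radius \<open>n\<close> the squared Green function sums to a product over levels of
  \<open>\<bar>m\<^sub>0\<bar>\<^sup>2 + \<bar>m\<^sub>1\<bar>\<^sup>2\<close>, where \<open>m\<^sub>0\<close>, \<open>m\<^sub>1\<close> are the forward Green functions at the level, and the
  outer levels enter the next inner one only through \<open>m\<^sub>0 + m\<^sub>1\<close>. Hence the moment of order \<open>1/2\<close> is an
  iterated transfer operator in one complex variable.

  For \<open>\<kappa> = 0\<close> and real energy this is the one-dimensional Anderson model: weighting each step by the
  full derivative to the power \<open>1/2\<close> gives the composition of an isometry of \<open>L\<^sup>2\<close>, a multiple of
  \<open>f (2 / t)\<close>, with averaging over the random potential. Averaging is a strict contraction except on functions
  spread over a large scale, which the inversion moves close to the origin, where an averaged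
  function has little mass; so the iterates decay. By the arithmetic-geometric mean inequality
  the \<open>N\<close>-th iterate of the moment operator applied to \<open>1\<close> is at most \<open>1/2\<close>, and the sum of the first
  \<open>N\<close> iterates is a Lyapunov function, which remains one for small \<open>\<kappa>\<close> and nearby complex
  energies.\<close>

section \<open>Integrals against a bounded density\<close>

text \<open>Why order 1/2: with \<open>\<kappa> = 0\<close> both children of a vertex have the
  forward Green function \<open>1 / (q - x)\<close>, and the norm of this pair,
  \<open>sqrt 2 / \<bar>q - x\<bar>\<close>, is exactly the square root of the derivative of the
  step map \<open>x \<mapsto> E + 2 / (q - x)\<close>. The branching number is thus absorbed in the
  hopping of a line. Weights to the power 1 belong to L2, weights to the power 0 to a Markov chain,
  and 1/2 is the midpoint to which the mean inequality applies. Two obstacles shape the argument.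
  The function 1 is not in L2, so it is split into a decaying and a growing weight; and the
  characteristic function of the potential tends to 1 at frequency 0, so averaging alone has no
  contraction factor and must be played against the inversion. The L2 picture is tied to the real
  line and to \<open>\<kappa> = 0\<close>: with different transversal values the step map has two
  poles and is no longer injective. The perturbation is therefore done for bounded, uniformly
  continuous functions on the complex plane.\<close>

lemma nn_integral_lborel_reflect:
  fixes c :: real
  assumes [measurable]: "f \<in> borel_measurable borel"
  shows "(\<integral>\<^sup>+x. f (c - x) \<partial>lborel) = (\<integral>\<^sup>+x. f x \<partial>lborel)"
  using nn_integral_real_affine[of f "-1" c] by simp

lemma nn_integral_powr_ball:
  assumes "a < 1" "0 \<le> r"
  shows "(\<integral>\<^sup>+t. ennreal (\<bar>t\<bar> powr - a) * indicator {-r..r} t \<partial>lborel) \<le> ennreal (2 * r powr (1 - a) / (1 - a))"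
proof -
  let ?f = "\<lambda>t::real. ennreal (t powr - a) * indicator {0..r} t"
  have f: "(\<integral>\<^sup>+t. ?f t \<partial>lborel) = ennreal (r powr (1 - a) / (1 - a))"
    using nn_integral_has_integral_lebesgue'[OF _ has_integral_powr_from_0[of "-a" r]] assms
    by simp
  have "(\<integral>\<^sup>+t. ennreal (\<bar>t\<bar> powr - a) * indicator {-r..r} t \<partial>lborel)
      \<le> (\<integral>\<^sup>+t. ?f t + ?f (0 - t) \<partial>lborel)"
    by (intro nn_integral_mono) (auto simp: indicator_def abs_if)
  also have "\<dots> = (\<integral>\<^sup>+t. ?f t \<partial>lborel) + (\<integral>\<^sup>+t. ?f (0 - t) \<partial>lborel)"
    by (subst nn_integral_add) auto
  also have "\<dots> = ennreal (r powr (1 - a) / (1 - a)) + ennreal (r powr (1 - a) / (1 - a))"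
    by (subst nn_integral_lborel_reflect) (auto simp: f)
  also have "\<dots> = ennreal (2 * r powr (1 - a) / (1 - a))"
    using assms by (simp flip: ennreal_plus)
  finally show ?thesis .
qed

text \<open>The substitution is singular at 0 and at infinity, so it is made on compact intervals
  that exhaust the half-line. The inequality is all that the L2 estimates use.\<close>

lemma nn_integral_inversion_pos:
  fixes h :: "real \<Rightarrow> ennreal"
  assumes [measurable]: "h \<in> borel_measurable borel"
  shows "(\<integral>\<^sup>+t. h (2 / t) * ennreal (2 / t\<^sup>2) * indicator {0<..} t \<partial>lborel)
    \<le> (\<integral>\<^sup>+t. h t * indicator {0<..} t \<partial>lborel)"
proof -
  let ?G = "\<lambda>t. h (2 / t) * ennreal (2 / t\<^sup>2)"
  let ?a = "\<lambda>n. 1 / (2 + real n)" and ?b = "\<lambda>n. 2 + real n"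
  let ?f = "\<lambda>n t. ?G t * indicator {?a n..?b n} t"
  have pos: "0 < ?a n" "?a n < ?b n" for n
  proof -
    show "0 < ?a n" by simp
    have "?a n < 1" by simp
    then show "?a n < ?b n" by linarith
  qed
  have "(\<integral>\<^sup>+t. ?G t * indicator {0<..} t \<partial>lborel) \<le> (\<integral>\<^sup>+t. (SUP n. ?f n t) \<partial>lborel)"
  proof (rule nn_integral_mono)
    fix t :: real
    show "?G t * indicator {0<..} t \<le> (SUP n. ?f n t)"
    proof (cases "t > 0")
      case True
      obtain n where n: "max t (1/t) < real n" using reals_Archimedean2 by blast
      have "?a n \<le> t" using n True by (auto simp: field_simps)
      then have "?G t * indicator {0<..} t = ?f n t" using n True by auto
      also have "\<dots> \<le> (SUP n. ?f n t)" by (rule SUP_upper) simp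
      finally show ?thesis .
    qed auto
  qed
  also have "\<dots> = (SUP n. \<integral>\<^sup>+t. ?f n t \<partial>lborel)"
  proof (rule nn_integral_monotone_convergence_SUP)
    have "?a (Suc n) \<le> ?a n" for n by (intro divide_left_mono) auto
    then show "incseq ?f"
      by (intro incseq_SucI le_funI mult_left_mono)
         (auto simp: indicator_def intro: order_trans)
  qed auto
  also have "\<dots> \<le> (\<integral>\<^sup>+t. h t * indicator {0<..} t \<partial>lborel)"
  proof (rule SUP_least)
    fix n
    \<comment> \<open>The substitution rule wants a nonnegative derivative. The sign makes the map
      increasing and is undone by reflecting \<open>h\<close>.\<close>
    let ?g = "\<lambda>t::real. - 2 / t" and ?g' = "\<lambda>t::real. 2 / t\<^sup>2"
    have "(\<integral>\<^sup>+x. h (- x) * indicator {?g (?a n)..?g (?b n)} x \<partial>lborel) =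
             (\<integral>\<^sup>+x. h (- ?g x) * ?g' x * indicator {?a n..?b n} x \<partial>lborel)"
    proof (rule nn_integral_substitution_aux[where f = "\<lambda>x. h (- x)"])
      show "(?g has_real_derivative ?g' x) (at x)" if "x \<in> {?a n..?b n}" for x
        using pos(1)[of n] that by (auto intro!: derivative_eq_intros simp: power2_eq_square)
      show "continuous_on {?a n..?b n} ?g'"
        using pos(1)[of n] by (intro continuous_intros) auto
    qed (use pos in auto)
    then have "(\<integral>\<^sup>+t. ?f n t \<partial>lborel) = (\<integral>\<^sup>+x. h (- x) * indicator {?g (?a n)..?g (?b n)} x \<partial>lborel)"
      by simp
    also have "\<dots> \<le> (\<integral>\<^sup>+x. h (0 - x) * indicator {0<..} (0 - x) \<partial>lborel)"
    proof (intro nn_integral_mono)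
      fix x :: real
      have "x < 0" if "x \<in> {?g (?a n)..?g (?b n)}"
      proof -
        have "?g (?b n) < 0" by (simp add: field_simps)
        then show ?thesis using that by (simp only: atLeastAtMost_iff) linarith
      qed
      then show "h (- x) * indicator {?g (?a n)..?g (?b n)} x \<le> h (0 - x) * indicator {0<..} (0 - x)"
        by (auto simp: indicator_def simp del: minus_divide_left)
    qed
    also have "\<dots> = (\<integral>\<^sup>+t. h t * indicator {0<..} t \<partial>lborel)"
      by (rule nn_integral_lborel_reflect) simp
    finally show "(\<integral>\<^sup>+t. ?f n t \<partial>lborel) \<le> (\<integral>\<^sup>+t. h t * indicator {0<..} t \<partial>lborel)" .
  qed
  finally show ?thesis .
qed

lemma nn_integral_inversion:
  fixes h :: "real \<Rightarrow> ennreal"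
  assumes [measurable]: "h \<in> borel_measurable borel"
  shows "(\<integral>\<^sup>+t. h (2 / t) * ennreal (2 / t\<^sup>2) \<partial>lborel) \<le> (\<integral>\<^sup>+t. h t \<partial>lborel)"
proof -
  let ?G = "\<lambda>t. h (2 / t) * ennreal (2 / t\<^sup>2)"
  \<comment> \<open>The origin lies in neither half-line; there the weight is 0, because division by
    zero gives 0.\<close>
  have "(\<integral>\<^sup>+t. ?G t \<partial>lborel) \<le> (\<integral>\<^sup>+t. ?G t * indicator {0<..} t + ?G t * indicator {0<..} (0 - t) \<partial>lborel)"
    by (intro nn_integral_mono) (auto simp: indicator_def)
  also have "\<dots> = (\<integral>\<^sup>+t. ?G t * indicator {0<..} t \<partial>lborel) + (\<integral>\<^sup>+t. ?G (0 - (0 - t)) * indicator {0<..} (0 - t) \<partial>lborel)"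
    by (subst nn_integral_add) auto
  also have "(\<integral>\<^sup>+t. ?G (0 - (0 - t)) * indicator {0<..} (0 - t) \<partial>lborel)
      = (\<integral>\<^sup>+t. h (- (2 / t)) * ennreal (2 / t\<^sup>2) * indicator {0<..} t \<partial>lborel)"
    by (subst nn_integral_lborel_reflect[where f = "\<lambda>t. ?G (0 - t) * indicator {0<..} t"]) auto
  also have "\<dots> \<le> (\<integral>\<^sup>+t. h (- t) * indicator {0<..} t \<partial>lborel)"
    by (rule nn_integral_inversion_pos[where h = "\<lambda>t. h (- t)"]) simp
  also have "\<dots> = (\<integral>\<^sup>+t. h t * indicator {..<0} t \<partial>lborel)"
    by (subst nn_integral_lborel_reflect[symmetric, where c = 0])
       (auto intro!: nn_integral_cong simp: indicator_def)
  also have "(\<integral>\<^sup>+t. ?G t * indicator {0<..} t \<partial>lborel) \<le> (\<integral>\<^sup>+t. h t * indicator {0<..} t \<partial>lborel)"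
    by (rule nn_integral_inversion_pos) simp
  also have "(\<integral>\<^sup>+t. h t * indicator {0<..} t \<partial>lborel) + (\<integral>\<^sup>+t. h t * indicator {..<0} t \<partial>lborel)
      = (\<integral>\<^sup>+t. h t * indicator {0<..} t + h t * indicator {..<0} t \<partial>lborel)"
    by (subst nn_integral_add) auto
  also have "\<dots> \<le> (\<integral>\<^sup>+t. h t \<partial>lborel)"
    by (intro nn_integral_mono) (auto simp: indicator_def)
  finally show ?thesis by (simp add: add_mono)
qed

section \<open>Fractional moments under a bounded density\<close>

locale bounded_density =
  fixes g :: "real \<Rightarrow> real" and B :: real
  assumes g_measurable [measurable]: "g \<in> borel_measurable borel"
    and g_nonneg: "0 \<le> g x" and g_le: "g x \<le> B"
    and prob_space_density: "prob_space (density lborel (\<lambda>x. ennreal (g x)))"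
begin

definition nu :: "real measure" where
  "nu = density lborel (\<lambda>x. ennreal (g x))"

lemma sets_nu [measurable_cong, simp]: "sets nu = sets borel"
  and space_nu [simp]: "space nu = UNIV"
  by (auto simp: nu_def)

sublocale nu: prob_space nu
  unfolding nu_def by (rule prob_space_density)

lemma B_nonneg: "0 \<le> B"
  using g_nonneg g_le order_trans by blast

lemma nn_integral_nu:
  assumes [measurable]: "f \<in> borel_measurable borel"
  shows "(\<integral>\<^sup>+q. f q \<partial>nu) = (\<integral>\<^sup>+q. ennreal (g q) * f q \<partial>lborel)"
  unfolding nu_def by (subst nn_integral_density) auto

lemma nn_integral_nu_le:
  assumes [measurable]: "f \<in> borel_measurable borel"
  shows "(\<integral>\<^sup>+q. f q \<partial>nu) \<le> ennreal B * (\<integral>\<^sup>+q. f q \<partial>lborel)"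
proof -
  have "(\<integral>\<^sup>+q. f q \<partial>nu) \<le> (\<integral>\<^sup>+q. ennreal B * f q \<partial>lborel)"
    unfolding nn_integral_nu[OF assms]
    by (intro nn_integral_mono mult_right_mono) (auto intro: ennreal_leI g_le)
  then show ?thesis by (simp add: nn_integral_cmult)
qed

lemma AE_nu_neq: "AE q in nu. q \<noteq> x"
  unfolding nu_def by (subst AE_density) (auto intro: AE_mp[OF AE_lborel_singleton[of x]])

text \<open>The radius is kept explicit: the bound is of order \<open>r powr (1 - a)\<close>, and
  its smallness for small \<open>r\<close> later controls the singular part of the perturbation
  argument.\<close>

lemma truncated_moment:
  assumes "a < 1" "0 \<le> r"
  shows "(\<integral>\<^sup>+q. ennreal (\<bar>q - x\<bar> powr - a) * indicator {-r..r} (q - x) \<partial>nu)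
    \<le> ennreal (B * (2 * r powr (1 - a) / (1 - a)))"
proof -
  let ?f = "\<lambda>t::real. ennreal (\<bar>t\<bar> powr - a) * indicator {-r..r} t"
  have "(\<integral>\<^sup>+q. ?f (q - x) \<partial>nu) \<le> ennreal B * (\<integral>\<^sup>+q. ?f (q - x) \<partial>lborel)"
    by (rule nn_integral_nu_le) simp
  also have "(\<integral>\<^sup>+q. ?f (q - x) \<partial>lborel) = (\<integral>\<^sup>+q. ?f q \<partial>lborel)"
    using nn_integral_real_affine[of ?f 1 "-x"] by (simp add: algebra_simps)
  also have "ennreal B * \<dots> \<le> ennreal B * ennreal (2 * r powr (1 - a) / (1 - a))"
    by (intro mult_left_mono nn_integral_powr_ball assms) auto
  also have "\<dots> = ennreal (B * (2 * r powr (1 - a) / (1 - a)))"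
    by (intro ennreal_mult[symmetric]) (use assms B_nonneg in auto)
  finally show ?thesis .
qed

lemma moment:
  assumes "0 \<le> a" "a < 1"
  shows "(\<integral>\<^sup>+q. ennreal (\<bar>q - x\<bar> powr - a) \<partial>nu) \<le> ennreal (1 + 2 * B / (1 - a))"
proof -
  have "(\<integral>\<^sup>+q. ennreal (\<bar>q - x\<bar> powr - a) \<partial>nu)
      \<le> (\<integral>\<^sup>+q. 1 + ennreal (\<bar>q - x\<bar> powr - a) * indicator {-1..1} (q - x) \<partial>nu)"
  proof (rule nn_integral_mono)
    fix q :: real
    have "\<bar>q - x\<bar> powr - a \<le> 1" if "q - x \<notin> {-1..1}"
    proof -
      have "1 \<le> \<bar>q - x\<bar>" using that by auto
      then have "\<bar>q - x\<bar> powr - a \<le> \<bar>q - x\<bar> powr 0"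
        using assms by (intro powr_mono) auto
      also have "\<dots> \<le> 1" by simp
      finally show ?thesis .
    qed
    then show "ennreal (\<bar>q - x\<bar> powr - a) \<le> 1 + ennreal (\<bar>q - x\<bar> powr - a) * indicator {-1..1} (q - x)"
      by (cases "q - x \<in> {-1..1}") (auto simp: ennreal_le_1 add_increasing)
  qed
  also have "\<dots> = 1 + (\<integral>\<^sup>+q. ennreal (\<bar>q - x\<bar> powr - a) * indicator {-1..1} (q - x) \<partial>nu)"
    by (subst nn_integral_add) (auto simp: nu.emeasure_space_1[simplified])
  also have "\<dots> \<le> 1 + ennreal (B * (2 * 1 powr (1 - a) / (1 - a)))"
    by (intro add_left_mono truncated_moment assms) auto
  also have "\<dots> = ennreal (1 + 2 * B / (1 - a))"
    using assms B_nonneg by (subst ennreal_plus) (auto simp: mult.commute)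
  finally show ?thesis .
qed

end

section \<open>Averaging contracts away from slowly varying functions\<close>

context bounded_density
begin

definition avg :: "(real \<Rightarrow> ennreal) \<Rightarrow> real \<Rightarrow> ennreal" where
  "avg f x = (\<integral>\<^sup>+q. f (q - x) \<partial>nu)"

lemma measurable_avg [measurable]:
  assumes [measurable]: "f \<in> borel_measurable borel"
  shows "avg f \<in> borel_measurable borel"
  unfolding avg_def by measurable

text \<open>A bounded density lets averaging map L2 into bounded functions. This turns L2 decay into
  uniform decay and supplies the supremum needed near the image of infinity.\<close>

lemma avg_square_le:
  assumes [measurable]: "f \<in> borel_measurable borel"
  shows "(avg f x)\<^sup>2 \<le> ennreal B * (\<integral>\<^sup>+u. (f u)\<^sup>2 \<partial>lborel)"
proof -
  have "(avg f x)\<^sup>2 \<le> (\<integral>\<^sup>+q. (f (q - x))\<^sup>2 \<partial>nu) * (\<integral>\<^sup>+q. 1\<^sup>2 \<partial>nu)"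
    unfolding avg_def using Cauchy_Schwarz_nn_integral[of "\<lambda>q. f (q - x)" nu "\<lambda>_. 1"] by simp
  also have "\<dots> = (\<integral>\<^sup>+q. (f (q - x))\<^sup>2 \<partial>nu)"
    by (simp add: nu.emeasure_space_1[simplified])
  also have "\<dots> \<le> ennreal B * (\<integral>\<^sup>+q. (f (q - x))\<^sup>2 \<partial>lborel)"
    by (rule nn_integral_nu_le) simp
  also have "(\<integral>\<^sup>+q. (f (q - x))\<^sup>2 \<partial>lborel) = (\<integral>\<^sup>+q. (f q)\<^sup>2 \<partial>lborel)"
    using nn_integral_real_affine[of "\<lambda>u. (f u)\<^sup>2" 1 "-x"] by (simp add: algebra_simps)
  finally show ?thesis .
qed

text \<open>Rotating the characteristic function at \<open>b\<close> to the positive axis writes its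
  modulus as the mean of \<open>cos (b * q - a)\<close>. The value 1 would confine \<open>q\<close>
  to the countable set of points \<open>(2 * pi * n + a) / b\<close>, which is null for a measure
  without atoms.\<close>

lemma char_less_1:
  assumes "0 < b"
  shows "(\<integral>q. cos (b * q) \<partial>nu)\<^sup>2 + (\<integral>q. sin (b * q) \<partial>nu)\<^sup>2 < 1"
proof -
  let ?C = "\<integral>q. cos (b * q) \<partial>nu" and ?D = "\<integral>q. sin (b * q) \<partial>nu"
  have int: "integrable nu (\<lambda>q. cos (b * q))" "integrable nu (\<lambda>q. sin (b * q))"
    by (auto intro!: nu.integrable_const_bound[where B = 1])
  obtain r a where ra: "0 \<le> r" "?C = r * cos a" "?D = r * sin a"
  proof -
    let ?z = "Complex ?C ?D"
    show ?thesis
      using that[of "cmod ?z" "Arg ?z"] Re_rcis[of "cmod ?z" "Arg ?z"] Im_rcis[of "cmod ?z" "Arg ?z"]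
      by (simp only: rcis_cmod_Arg complex.sel norm_ge_zero)
  qed
  have r: "?C\<^sup>2 + ?D\<^sup>2 = r\<^sup>2"
    using ra by (simp add: power_mult_distrib flip: distrib_left)
  have "r = ?C * cos a + ?D * sin a"
    using ra by (simp add: mult.assoc flip: distrib_left power2_eq_square)
  also have "\<dots> = (\<integral>q. cos (b * q) * cos a + sin (b * q) * sin a \<partial>nu)"
    using int by simp
  also have "\<dots> = (\<integral>q. cos (b * q - a) \<partial>nu)"
    by (simp add: cos_diff)
  finally have reqn: "r = (\<integral>q. cos (b * q - a) \<partial>nu)" .
  have int': "integrable nu (\<lambda>q. 1 - cos (b * q - a))"
    by (rule nu.integrable_const_bound[where B = 2]) (auto intro: order_trans[OF abs_triangle_ineq4])
  have "1 - r = (\<integral>q. 1 - cos (b * q - a) \<partial>nu)"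
    using reqn by (subst Bochner_Integration.integral_diff)
      (auto intro!: nu.integrable_const_bound[where B = 1] simp: nu.prob_space[simplified])
  moreover have "(\<integral>q. 1 - cos (b * q - a) \<partial>nu) \<noteq> 0"
  proof
    assume "(\<integral>q. 1 - cos (b * q - a) \<partial>nu) = 0"
    then have "AE q in nu. 1 - cos (b * q - a) = 0"
      by (subst (asm) integral_nonneg_eq_0_iff_AE[OF int']) auto
    moreover have "AE q in nu. \<forall>n\<in>\<int>. q \<noteq> (n * 2 * pi + a) / b"
      by (subst AE_ball_countable) (auto simp: countable_int AE_nu_neq)
    ultimately have "AE q in nu. False"
    proof eventually_elim
      case (elim q)
      then have "cos (b * q - a) = 1" by simp
      then obtain n :: int where "b * q - a = of_int n * 2 * pi"
        by (auto simp: cos_one_2pi_int)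
      then have "q = (of_int n * 2 * pi + a) / b"
        using assms by (simp add: field_simps)
      with elim show False by auto
    qed
    then show False by simp
  qed
  moreover have "(\<integral>q. 1 - cos (b * q - a) \<partial>nu) \<ge> 0"
    by (intro integral_nonneg_AE) auto
  ultimately have "r < 1" by linarith
  then show ?thesis
    using ra(1) unfolding r by (simp add: power_less_one_iff abs_square_less_1)
qed

text \<open>The quotient is \<open>1 - (1 - m) * cos y / (2 + cos y)\<close>, where
  \<open>cos y / (2 + cos y)\<close> increases with \<open>cos y\<close>: it is -1 at
  \<open>cos y = -1\<close> and at least 1/5 once \<open>cos y\<close> is at least 1/2.\<close>

lemma cos_quotient_bound:
  fixes m y :: real
  assumes "m < 1"
  shows "(2 + m * cos y) / (2 + cos y) \<le> 1 + (1 - m)"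
    and "\<bar>y\<bar> \<le> 1 \<Longrightarrow> (2 + m * cos y) / (2 + cos y) \<le> 1 - (1 - m) / 5"
proof -
  have p: "0 < 2 + cos y" using cos_ge_minus_one[of y] by linarith
  have "0 \<le> (1 - m) * (2 + 2 * cos y)"
    using assms cos_ge_minus_one[of y] by (intro mult_nonneg_nonneg) linarith+
  then have "2 + m * cos y \<le> (1 + (1 - m)) * (2 + cos y)" by (simp add: algebra_simps)
  then show "(2 + m * cos y) / (2 + cos y) \<le> 1 + (1 - m)" using p by (simp add: divide_le_eq)
  assume y: "\<bar>y\<bar> \<le> 1"
  have "1 - y\<^sup>2 / 2 \<le> cos y"
    using cos_double_sin[of "y/2"] abs_sin_x_le_abs_x[of "y/2"]
    unfolding abs_le_square_iff by (simp add: power_divide)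
  moreover have "y\<^sup>2 \<le> 1" using y by (simp add: abs_square_le_1)
  ultimately have "1 / 2 \<le> cos y" by linarith
  then have "0 \<le> (1 - m) * (4 * cos y - 2)"
    using assms by (intro mult_nonneg_nonneg) auto
  then have "2 + m * cos y \<le> (1 - (1 - m) / 5) * (2 + cos y)" by (simp add: field_simps)
  then show "(2 + m * cos y) / (2 + cos y) \<le> 1 - (1 - m) / 5" using p by (simp add: divide_le_eq)
qed

text \<open>The Schur test with weight \<open>2 + cos (b u)\<close>, \<open>b = 1 / R\<close>: averaging over the difference of two
  independent potentials multiplies the cosine by some \<open>m < 1\<close>, so the gain near the origin and the
  loss far away are both of order \<open>1 - m\<close>, whatever \<open>R\<close> is.\<close>

lemma avg_L2_bound:
  assumes "0 < R"
  obtains c where "0 < c" "c < 1"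
    "\<And>f. f \<in> borel_measurable borel \<Longrightarrow> (\<integral>\<^sup>+x. (avg f x)\<^sup>2 \<partial>lborel)
      \<le> ennreal (1 - c) * (\<integral>\<^sup>+u. (f u)\<^sup>2 \<partial>lborel)
        + ennreal (6 * c) * (\<integral>\<^sup>+u. (f u)\<^sup>2 * indicator {u. R < \<bar>u\<bar>} u \<partial>lborel)"
proof -
  define b where "b = 1 / R"
  have b: "0 < b" using assms by (simp add: b_def)
  define C where "C = (\<integral>q. cos (b * q) \<partial>nu)"
  define D where "D = (\<integral>q. sin (b * q) \<partial>nu)"
  define m where "m = C\<^sup>2 + D\<^sup>2"
  define c where "c = (1 - m) / 5"
  define r where "r u = 2 + cos (b * u)" for u
  define ar where "ar x = 2 + C * cos (b * x) + D * sin (b * x)" for x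
  have m1: "m < 1" using char_less_1[OF b] by (simp add: m_def C_def D_def)
  have m0: "0 \<le> m" by (simp add: m_def)
  have rpos: "0 < r u" for u unfolding r_def using cos_ge_minus_one[of "b * u"] by linarith
  have rm [measurable]: "r \<in> borel_measurable borel" "ar \<in> borel_measurable borel"
    unfolding r_def ar_def by measurable
  have int: "integrable nu (\<lambda>q. cos (b * q))" "integrable nu (\<lambda>q. sin (b * q))"
    by (auto intro!: nu.integrable_const_bound[where B = 1])
  \<comment> \<open>Averaging preserves the span of 1, cosine and sine of frequency
    \<open>b\<close>. The coefficients \<open>(1, 0)\<close> give the average \<open>ar\<close> of
    the weight \<open>r\<close>, and \<open>(C, D)\<close> the second average.\<close>
  have shift: "(\<integral>q. 2 + x1 * cos (b * (q - x)) + x2 * sin (b * (q - x)) \<partial>nu)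
      = 2 + x1 * (C * cos (b * x) + D * sin (b * x)) + x2 * (D * cos (b * x) - C * sin (b * x))"
    and shift_int: "integrable nu (\<lambda>q. 2 + x1 * cos (b * (q - x)) + x2 * sin (b * (q - x)))" for x x1 x2
  proof -
    have e: "2 + x1 * cos (b * (q - x)) + x2 * sin (b * (q - x))
      = 2 + (x1 * cos (b * x) - x2 * sin (b * x)) * cos (b * q) + (x1 * sin (b * x) + x2 * cos (b * x)) * sin (b * q)" for q
      by (simp add: right_diff_distrib cos_diff sin_diff algebra_simps)
    show "integrable nu (\<lambda>q. 2 + x1 * cos (b * (q - x)) + x2 * sin (b * (q - x)))"
      unfolding e using int by auto
    have "(\<integral>q. 2 + x1 * cos (b * (q - x)) + x2 * sin (b * (q - x)) \<partial>nu)
      = 2 + (x1 * cos (b * x) - x2 * sin (b * x)) * C + (x1 * sin (b * x) + x2 * cos (b * x)) * D"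
      unfolding e C_def D_def using int by (simp add: nu.prob_space[simplified])
    then show "(\<integral>q. 2 + x1 * cos (b * (q - x)) + x2 * sin (b * (q - x)) \<partial>nu)
      = 2 + x1 * (C * cos (b * x) + D * sin (b * x)) + x2 * (D * cos (b * x) - C * sin (b * x))"
      by (simp add: algebra_simps)
  qed
  have ar1: "(\<integral>\<^sup>+q. ennreal (r (q - x)) \<partial>nu) = ennreal (ar x)" for x
    using shift[of 1 x 0] shift_int[of 1 x 0] rpos[THEN less_imp_le]
    by (subst nn_integral_eq_integral) (auto simp: r_def ar_def add.assoc)
  have ar0: "0 \<le> ar x" for x
  proof -
    have "0 \<le> (\<integral>q. r (q - x) \<partial>nu)" using rpos by (intro integral_nonneg_AE) (auto intro: less_imp_le)
    then show ?thesis using shift[of 1 x 0] by (simp add: r_def ar_def)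
  qed
  have ar2: "(\<integral>\<^sup>+q. ennreal (ar (q - x)) \<partial>nu) = ennreal (2 + m * cos (b * x))" for x
  proof -
    have "integrable nu (\<lambda>q. ar (q - x))"
      using shift_int[of C x D] by (simp add: ar_def)
    moreover have "(\<integral>q. ar (q - x) \<partial>nu) = 2 + m * cos (b * x)"
      using shift[of C x D] by (simp add: ar_def m_def power2_eq_square) (simp add: algebra_simps)
    ultimately show ?thesis by (subst nn_integral_eq_integral) (auto simp: ar0)
  qed
  \<comment> \<open>The gain near the origin is \<open>c\<close>; far away the loss is
    \<open>1 - m = 5 * c\<close>, so the indicator has to carry \<open>6 * c\<close>.\<close>
  have quot: "1 / r u * (2 + m * cos (b * u)) \<le> 1 - c + 6 * c * indicator {u. R < \<bar>u\<bar>} u" for u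
  proof (cases "R < \<bar>u\<bar>")
    case True
    moreover have "1 - c + 6 * c = 1 + (1 - m)" by (simp add: c_def field_simps)
    ultimately show ?thesis using cos_quotient_bound(1)[OF m1, of "b * u"] by (simp add: r_def)
  next
    case False
    then have "\<bar>b * u\<bar> \<le> 1" using assms by (simp add: b_def abs_mult field_simps)
    then show ?thesis using cos_quotient_bound(2)[OF m1, of "b * u"] False by (simp add: r_def c_def)
  qed
  have c: "0 < c" "c < 1" using m1 m0 by (auto simp: c_def)
  show ?thesis
  proof (rule that[OF c])
    fix f :: "real \<Rightarrow> ennreal" assume [measurable]: "f \<in> borel_measurable borel"
    interpret P: pair_sigma_finite nu lborel ..
    let ?h = "\<lambda>u. (f u)\<^sup>2 * ennreal (1 / r u)"
    have rsq: "(ennreal (sqrt (r u)))\<^sup>2 = ennreal (r u)" for u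
      using rpos[of u] by (subst ennreal_power) auto
    have rinv: "ennreal (1 / sqrt (r u)) * ennreal (sqrt (r u)) = 1" for u
      using rpos[of u] by (subst ennreal_mult[symmetric]) auto
    have "(ennreal (1 / sqrt (r u)))\<^sup>2 = ennreal (1 / r u)" for u
      using rpos[of u] by (subst ennreal_power) (auto simp: power_divide)
    then have hsq: "(f u * ennreal (1 / sqrt (r v)))\<^sup>2 = (f u)\<^sup>2 * ennreal (1 / r v)" for u v
      by (simp only: power_mult_distrib)
    have cs: "(avg f x)\<^sup>2 \<le> (\<integral>\<^sup>+q. ?h (q - x) * ennreal (ar x) \<partial>nu)" for x
    proof -
      have e: "avg f x = (\<integral>\<^sup>+q. (f (q - x) * ennreal (1 / sqrt (r (q - x)))) * ennreal (sqrt (r (q - x))) \<partial>nu)"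
        unfolding avg_def by (simp only: mult.assoc rinv mult_1_right)
      have "(avg f x)\<^sup>2 \<le> (\<integral>\<^sup>+q. (f (q - x) * ennreal (1 / sqrt (r (q - x))))\<^sup>2 \<partial>nu) * (\<integral>\<^sup>+q. (ennreal (sqrt (r (q - x))))\<^sup>2 \<partial>nu)"
        unfolding e by (rule Cauchy_Schwarz_nn_integral) auto
      also have "\<dots> = (\<integral>\<^sup>+q. ?h (q - x) \<partial>nu) * ennreal (ar x)"
        by (simp only: hsq rsq ar1)
      also have "\<dots> = (\<integral>\<^sup>+q. ?h (q - x) * ennreal (ar x) \<partial>nu)"
        by (rule nn_integral_multc[symmetric]) measurable
      finally show ?thesis .
    qed
    have "(\<integral>\<^sup>+x. (avg f x)\<^sup>2 \<partial>lborel) \<le> (\<integral>\<^sup>+x. \<integral>\<^sup>+q. ?h (q - x) * ennreal (ar x) \<partial>nu \<partial>lborel)"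
      by (intro nn_integral_mono cs)
    also have "\<dots> = (\<integral>\<^sup>+q. \<integral>\<^sup>+x. ?h (q - x) * ennreal (ar x) \<partial>lborel \<partial>nu)"
      by (rule P.Fubini') simp
    also have "\<dots> = (\<integral>\<^sup>+q. \<integral>\<^sup>+u. ?h u * ennreal (ar (q - u)) \<partial>lborel \<partial>nu)"
    proof (rule nn_integral_cong)
      fix q
      show "(\<integral>\<^sup>+x. ?h (q - x) * ennreal (ar x) \<partial>lborel) = (\<integral>\<^sup>+u. ?h u * ennreal (ar (q - u)) \<partial>lborel)"
        using nn_integral_lborel_reflect[of "\<lambda>u. ?h u * ennreal (ar (q - u))" q] by simp
    qed
    also have "\<dots> = (\<integral>\<^sup>+u. \<integral>\<^sup>+q. ?h u * ennreal (ar (q - u)) \<partial>nu \<partial>lborel)"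
      by (rule P.Fubini'[symmetric]) simp
    also have "\<dots> = (\<integral>\<^sup>+u. (f u)\<^sup>2 * ennreal (1 / r u * (2 + m * cos (b * u))) \<partial>lborel)"
    proof (rule nn_integral_cong)
      fix u
      have "\<bar>m * cos (b * u)\<bar> \<le> 1 * 1" unfolding abs_mult using m0 m1 by (intro mult_mono) auto
      then have "0 \<le> 2 + m * cos (b * u)" by linarith
      then show "(\<integral>\<^sup>+q. ?h u * ennreal (ar (q - u)) \<partial>nu) = (f u)\<^sup>2 * ennreal (1 / r u * (2 + m * cos (b * u)))"
        using rpos[of u] by (subst nn_integral_cmult) (auto simp: ar2 mult.assoc less_imp_le simp flip: ennreal_mult)
    qed
    also have "\<dots> \<le> (\<integral>\<^sup>+u. ennreal (1 - c) * (f u)\<^sup>2 + ennreal (6 * c) * ((f u)\<^sup>2 * indicator {u. R < \<bar>u\<bar>} u) \<partial>lborel)"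
    proof (intro nn_integral_mono)
      fix u
      have "(f u)\<^sup>2 * ennreal (1 / r u * (2 + m * cos (b * u)))
          \<le> (f u)\<^sup>2 * ennreal (1 - c + 6 * c * indicator {u. R < \<bar>u\<bar>} u)"
        by (intro mult_left_mono ennreal_leI quot) auto
      also have "\<dots> = ennreal (1 - c) * (f u)\<^sup>2 + ennreal (6 * c) * ((f u)\<^sup>2 * indicator {u. R < \<bar>u\<bar>} u)"
        using c by (subst ennreal_plus) (auto simp: distrib_left mult_ac indicator_def)
      finally show "(f u)\<^sup>2 * ennreal (1 / r u * (2 + m * cos (b * u)))
        \<le> ennreal (1 - c) * (f u)\<^sup>2 + ennreal (6 * c) * ((f u)\<^sup>2 * indicator {u. R < \<bar>u\<bar>} u)" .
    qed
    also have "\<dots> = ennreal (1 - c) * (\<integral>\<^sup>+u. (f u)\<^sup>2 \<partial>lborel)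
        + ennreal (6 * c) * (\<integral>\<^sup>+u. (f u)\<^sup>2 * indicator {u. R < \<bar>u\<bar>} u \<partial>lborel)"
      by (subst nn_integral_add) (auto simp: nn_integral_cmult)
    finally show "(\<integral>\<^sup>+x. (avg f x)\<^sup>2 \<partial>lborel)
      \<le> ennreal (1 - c) * (\<integral>\<^sup>+u. (f u)\<^sup>2 \<partial>lborel)
        + ennreal (6 * c) * (\<integral>\<^sup>+u. (f u)\<^sup>2 * indicator {u. R < \<bar>u\<bar>} u \<partial>lborel)" .
  qed
qed

end

section \<open>Decay of the one-dimensional chain\<close>

text \<open>For a real tail sum the step \<open>x \<mapsto> E + 2 / (q - x)\<close>, weighted by \<open>sqrt 2 / \<bar>q - x\<bar>\<close>, is the
  operator \<open>avg \<circ> inv_op E\<close>; the weight makes \<open>inv_op E\<close> an isometry of \<open>L\<^sup>2\<close>.\<close>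

definition inv_op :: "real \<Rightarrow> (real \<Rightarrow> ennreal) \<Rightarrow> real \<Rightarrow> ennreal" where
  "inv_op E f t = ennreal (sqrt 2 / \<bar>t\<bar>) * f (E + 2 / t)"

lemma measurable_inv_op [measurable]:
  assumes [measurable]: "f \<in> borel_measurable borel"
  shows "inv_op E f \<in> borel_measurable borel"
  unfolding inv_op_def by measurable

lemma inv_op_square: "(inv_op E f t)\<^sup>2 = (f (E + 2 / t))\<^sup>2 * ennreal (2 / t\<^sup>2)"
  by (simp add: inv_op_def power_mult_distrib ennreal_power power_divide mult.commute)

lemma inv_op_L2:
  assumes [measurable]: "f \<in> borel_measurable borel"
  shows "(\<integral>\<^sup>+t. (inv_op E f t)\<^sup>2 \<partial>lborel) \<le> (\<integral>\<^sup>+x. (f x)\<^sup>2 \<partial>lborel)"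
proof -
  have "(\<integral>\<^sup>+t. (inv_op E f t)\<^sup>2 \<partial>lborel) \<le> (\<integral>\<^sup>+x. (f (E + x))\<^sup>2 \<partial>lborel)"
    unfolding inv_op_square using nn_integral_inversion[of "\<lambda>x. (f (E + x))\<^sup>2"] by simp
  also have "\<dots> = (\<integral>\<^sup>+x. (f x)\<^sup>2 \<partial>lborel)"
    using nn_integral_real_affine[of "\<lambda>u. (f u)\<^sup>2" 1 E] by simp
  finally show ?thesis .
qed

text \<open>Inversion sends the far region to an interval of length \<open>4 / R\<close> around
  \<open>E\<close>, where a supremum bound on \<open>f\<close> is enough.\<close>

lemma inv_op_L2_tail:
  assumes [measurable]: "f \<in> borel_measurable borel" and R: "0 < R" and M: "\<And>x. (f x)\<^sup>2 \<le> M"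
  shows "(\<integral>\<^sup>+t. (inv_op E f t)\<^sup>2 * indicator {t. R < \<bar>t\<bar>} t \<partial>lborel) \<le> M * ennreal (4 / R)"
proof -
  have "(\<integral>\<^sup>+t. (inv_op E f t)\<^sup>2 * indicator {t. R < \<bar>t\<bar>} t \<partial>lborel)
      \<le> (\<integral>\<^sup>+t. (M * indicator {-2/R..2/R} (2 / t)) * ennreal (2 / t\<^sup>2) \<partial>lborel)"
  proof (intro nn_integral_mono)
    fix t :: real
    have "- (2 / R) \<le> 2 / t \<and> 2 / t \<le> 2 / R" if "R < \<bar>t\<bar>"
    proof -
      have "\<bar>2 / t\<bar> \<le> 2 / R" using that R by (auto simp: abs_divide intro!: divide_left_mono)
      then show ?thesis by linarith
    qed
    then show "(inv_op E f t)\<^sup>2 * indicator {t. R < \<bar>t\<bar>} t \<le> (M * indicator {-2/R..2/R} (2 / t)) * ennreal (2 / t\<^sup>2)"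
      unfolding inv_op_square using M by (auto simp: indicator_def intro!: mult_right_mono)
  qed
  also have "\<dots> \<le> (\<integral>\<^sup>+x. M * indicator {-2/R..2/R} x \<partial>lborel)"
    by (rule nn_integral_inversion) simp
  also have "\<dots> = M * ennreal (4 / R)"
    using R by (simp add: nn_integral_cmult)
  finally show ?thesis .
qed

context bounded_density
begin

definition chain :: "real \<Rightarrow> (real \<Rightarrow> ennreal) \<Rightarrow> nat \<Rightarrow> real \<Rightarrow> ennreal" where
  "chain E f n = ((\<lambda>f. avg (inv_op E f)) ^^ n) f"

lemma chain_0 [simp]: "chain E f 0 = f"
  and chain_Suc: "chain E f (Suc n) = avg (inv_op E (chain E f n))"
  by (simp_all add: chain_def)

lemma measurable_chain [measurable]:
  assumes [measurable]: "f \<in> borel_measurable borel"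
  shows "chain E f n \<in> borel_measurable borel"
  by (induction n) (simp_all add: chain_Suc)

text \<open>The squared L2 norms \<open>b n\<close> obey a two-step recursion: the far part of an
  iterate is controlled by the supremum of the function inverted, and averaging bounds this supremum
  by the L2 norm one step earlier. Geometric decay of \<open>b n\<close> then gives uniform decay by
  the same smoothing.\<close>

lemma chain_tendsto_0:
  assumes [measurable]: "f \<in> borel_measurable borel"
    and fin: "(\<integral>\<^sup>+t. (inv_op E f t)\<^sup>2 \<partial>lborel) < \<infinity>" and e: "0 < e"
  obtains n where "0 < n" "\<And>x. chain E f n x \<le> ennreal e"
proof -
  define b where "b n = (\<integral>\<^sup>+t. (inv_op E (chain E f n) t)\<^sup>2 \<partial>lborel)" for n
  \<comment> \<open>The far part contributes \<open>6 * c * B * (4 / R)\<close> times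
    \<open>b n\<close>; \<open>R\<close> is at least \<open>48 * B\<close> so that this is at most
    \<open>c / 2\<close>, half of the gain.\<close>
  define R where "R = 48 * B + 1"
  have R: "0 < R" using B_nonneg by (simp add: R_def)
  obtain c where c: "0 < c" "c < 1"
    and avg: "\<And>f. f \<in> borel_measurable borel \<Longrightarrow> (\<integral>\<^sup>+x. (avg f x)\<^sup>2 \<partial>lborel)
      \<le> ennreal (1 - c) * (\<integral>\<^sup>+u. (f u)\<^sup>2 \<partial>lborel)
        + ennreal (6 * c) * (\<integral>\<^sup>+u. (f u)\<^sup>2 * indicator {u. R < \<bar>u\<bar>} u \<partial>lborel)"
    by (rule avg_L2_bound[OF R]) (rule that)
  have chain_sq: "(chain E f (Suc n) x)\<^sup>2 \<le> ennreal B * b n" for n x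
    unfolding chain_Suc b_def by (rule avg_square_le) simp
  have b_Suc: "b (Suc n) \<le> (\<integral>\<^sup>+x. (avg (inv_op E (chain E f n)) x)\<^sup>2 \<partial>lborel)" for n
    unfolding b_def chain_Suc by (rule inv_op_L2) simp
  have rec: "b (Suc (Suc n)) \<le> ennreal (1 - c) * b (Suc n) + ennreal (c / 2) * b n" for n
  proof -
    have "b (Suc (Suc n)) \<le> ennreal (1 - c) * b (Suc n) + ennreal (6 * c) * (ennreal B * b n * ennreal (4 / R))"
    proof (rule order_trans[OF b_Suc], rule order_trans[OF avg])
      show "ennreal (1 - c) * (\<integral>\<^sup>+u. (inv_op E (chain E f (Suc n)) u)\<^sup>2 \<partial>lborel)
         + ennreal (6 * c) * (\<integral>\<^sup>+u. (inv_op E (chain E f (Suc n)) u)\<^sup>2 * indicator {u. R < \<bar>u\<bar>} u \<partial>lborel)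
         \<le> ennreal (1 - c) * b (Suc n) + ennreal (6 * c) * (ennreal B * b n * ennreal (4 / R))"
        unfolding b_def[of "Suc n"]
        by (intro add_left_mono mult_left_mono inv_op_L2_tail R chain_sq) auto
    qed simp
    also have "ennreal (6 * c) * (ennreal B * b n * ennreal (4 / R)) = ennreal (6 * c * B * (4 / R)) * b n"
    proof -
      have "ennreal (6 * c * B * (4 / R)) = ennreal (6 * c) * ennreal B * ennreal (4 / R)"
        by (subst ennreal_mult, (use c B_nonneg R in simp)+, subst ennreal_mult) (use c B_nonneg in auto)
      then show ?thesis by (simp only: mult_ac)
    qed
    also have "\<dots> \<le> ennreal (c / 2) * b n"
      using c R B_nonneg by (intro mult_right_mono ennreal_leI) (auto simp: field_simps R_def)
    finally show ?thesis by (simp add: add_left_mono)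
  qed
  \<comment> \<open>A rate admissible for the recursion:
    \<open>r * r - ((1 - c) * r + c / 2)\<close> equals \<open>c * (4 - 3 * c) / 16\<close>, which
    is not negative.\<close>
  define r where "r = 1 - c / 4"
  have r: "0 < r" "r < 1" using c by (auto simp: r_def)
  have b1: "b (Suc 0) \<le> ennreal 7 * b 0"
  proof (rule order_trans[OF b_Suc], rule order_trans[OF avg])
    have "ennreal (1 - c) * b 0 + ennreal (6 * c) * (\<integral>\<^sup>+u. (inv_op E f u)\<^sup>2 * indicator {u. R < \<bar>u\<bar>} u \<partial>lborel)
        \<le> ennreal 1 * b 0 + ennreal 6 * b 0"
      unfolding b_def using c
      by (intro add_mono mult_mono ennreal_leI nn_integral_mono) (auto simp: indicator_def)
    also have "\<dots> = ennreal 7 * b 0"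
      by (subst distrib_right[symmetric]) simp
    finally show "ennreal (1 - c) * (\<integral>\<^sup>+u. (inv_op E (chain E f 0) u)\<^sup>2 \<partial>lborel)
        + ennreal (6 * c) * (\<integral>\<^sup>+u. (inv_op E (chain E f 0) u)\<^sup>2 * indicator {u. R < \<bar>u\<bar>} u \<partial>lborel)
        \<le> ennreal 7 * b 0" by (simp add: b_def)
  qed simp
  obtain d where d: "0 \<le> d" "b 0 = ennreal d" using fin unfolding b_def chain_0 by (auto elim: ennreal_cases)
  \<comment> \<open>Makes \<open>D * r\<close> equal to the bound \<open>7 * d\<close> on
    \<open>b 1\<close>, so that both starting values of the recursion are covered.\<close>
  define D where "D = 7 * d / r"
  have D0: "0 \<le> D" using d r by (simp add: D_def)
  have geo: "b n \<le> ennreal (D * r ^ n) \<and> b (Suc n) \<le> ennreal (D * r ^ Suc n)" for n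
  proof (induction n)
    case 0
    have "d * r \<le> d * 1" using d r by (intro mult_left_mono) auto
    then have "d * r \<le> 7 * d" using d by linarith
    then have "d \<le> D" using r by (simp add: D_def le_divide_eq)
    moreover have "b (Suc 0) \<le> ennreal (7 * d)" using b1 d by (simp add: ennreal_mult)
    ultimately show ?case using d r by (auto simp: D_def intro: ennreal_leI)
  next
    case (Suc n)
    have "b (Suc (Suc n)) \<le> ennreal (1 - c) * ennreal (D * r ^ Suc n) + ennreal (c / 2) * ennreal (D * r ^ n)"
      by (rule order_trans[OF rec]) (use Suc in \<open>auto intro!: add_mono mult_left_mono\<close>)
    also have "\<dots> = ennreal ((1 - c) * (D * r ^ Suc n) + c / 2 * (D * r ^ n))"
    proof -
      have nn: "0 \<le> 1 - c" "0 \<le> c / 2" "0 \<le> D * r ^ Suc n" "0 \<le> D * r ^ n"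
        using c D0 r by auto
      then show ?thesis
        by (simp only: ennreal_mult[symmetric] ennreal_plus[symmetric] mult_nonneg_nonneg)
    qed
    also have "\<dots> \<le> ennreal (D * r ^ Suc (Suc n))"
    proof (rule ennreal_leI)
      have "0 \<le> c * (4 - 3 * c)" using c by (intro mult_nonneg_nonneg) auto
      then have "(1 - c) * r + c / 2 \<le> r * r" by (simp add: r_def field_simps)
      then have "((1 - c) * r + c / 2) * (D * r ^ n) \<le> r * r * (D * r ^ n)"
        using D0 r by (intro mult_right_mono) auto
      then show "(1 - c) * (D * r ^ Suc n) + c / 2 * (D * r ^ n) \<le> D * r ^ Suc (Suc n)"
        by (simp add: algebra_simps)
    qed
    finally show ?case using Suc by simp
  qed
  have "(\<lambda>n. B * (D * r ^ n)) \<longlonglongrightarrow> B * (D * 0)"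
    using r by (intro tendsto_intros LIMSEQ_power_zero) auto
  then have "eventually (\<lambda>n. B * (D * r ^ n) < e\<^sup>2) sequentially"
    using e by (intro order_tendstoD) auto
  then obtain n where n: "B * (D * r ^ n) < e\<^sup>2" by (auto simp: eventually_sequentially)
  have "chain E f (Suc n) x \<le> ennreal e" for x
  proof -
    have "(chain E f (Suc n) x)\<^sup>2 \<le> ennreal B * ennreal (D * r ^ n)"
      by (rule order_trans[OF chain_sq]) (use geo[of n] in \<open>auto intro: mult_left_mono\<close>)
    also have "\<dots> \<le> ennreal (e\<^sup>2)"
      using n B_nonneg D0 r by (subst ennreal_mult[symmetric]) (auto intro: ennreal_leI)
    finally have "(chain E f (Suc n) x)\<^sup>2 \<le> ennreal (e\<^sup>2)" .
    then show ?thesis using e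
      by (cases "chain E f (Suc n) x" rule: ennreal_cases)
         (auto simp: ennreal_power top_unique intro!: ennreal_leI dest: power2_le_imp_le)
  qed
  then show ?thesis using that[of "Suc n"] by blast
qed

end

section \<open>The radial operator on the complex plane\<close>

lemma ennreal_inverse_antimono: "x \<le> y \<Longrightarrow> inverse y \<le> inverse (x :: ennreal)"
proof (cases "x = 0 \<or> y = \<top>")
  case False
  assume le: "x \<le> y"
  obtain s where s: "0 \<le> s" "y = ennreal s" using False by (cases y) auto
  obtain r where r: "0 < r" "x = ennreal r"
    using False le s by (cases x) (auto simp: top_unique order_le_less)
  then show "inverse y \<le> inverse x"
    using le s by (simp add: inverse_ennreal ennreal_leI)
qed auto

context bounded_density
begin

text \<open>The weight is the square root of the norm of the pair of equal forward Green functions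
  \<open>1 / (q - X)\<close>, the moment of order 1/2. The energy is real here although
  \<open>X\<close> may be complex.\<close>

definition radial_op :: "real \<Rightarrow> (complex \<Rightarrow> ennreal) \<Rightarrow> complex \<Rightarrow> ennreal" where
  "radial_op E f X = (\<integral>\<^sup>+q. ennreal (sqrt (sqrt 2 / cmod (of_real q - X))) * f (of_real E + 2 / (of_real q - X)) \<partial>nu)"

definition markov_op :: "real \<Rightarrow> (real \<Rightarrow> ennreal) \<Rightarrow> real \<Rightarrow> ennreal" where
  "markov_op E f x = (\<integral>\<^sup>+q. f (E + 2 / (q - x)) \<partial>nu)"

lemma measurable_radial_op [measurable]:
  assumes [measurable]: "f \<in> borel_measurable borel"
  shows "radial_op E f \<in> borel_measurable borel"
  unfolding radial_op_def by measurable

lemma measurable_markov_op [measurable]: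
  assumes [measurable]: "f \<in> borel_measurable borel"
  shows "markov_op E f \<in> borel_measurable borel"
  unfolding markov_op_def by measurable

lemma measurable_markov_op_iterate [measurable]:
  assumes [measurable]: "f \<in> borel_measurable borel"
  shows "(markov_op E ^^ n) f \<in> borel_measurable borel"
  by (induction n) simp_all

lemma measurable_radial_op_iterate [measurable]:
  assumes [measurable]: "f \<in> borel_measurable borel"
  shows "(radial_op E ^^ n) f \<in> borel_measurable borel"
  by (induction n) simp_all

text \<open>Fractional moments are traded for the \<open>L\<^sup>2\<close> operator with weight to the power 1 and the Markov
  operator with weight to the power 0. Having the bound for all \<open>t\<close> lets the induction absorb the
  step weight into \<open>t\<close>.\<close>

lemma radial_op_iterate_amgm:
  assumes [measurable]: "\<phi> \<in> borel_measurable borel" "\<psi> \<in> borel_measurable borel"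
    and base: "\<And>t x. 0 < t \<Longrightarrow> 1 \<le> ennreal (t / 2) * \<phi> x + ennreal (1 / (2 * t)) * \<psi> x"
    and t: "0 < t"
  shows "(radial_op E ^^ n) (\<lambda>_. 1) (of_real x)
    \<le> ennreal (t / 2) * chain E \<phi> n x + ennreal (1 / (2 * t)) * (markov_op E ^^ n) \<psi> x"
  using t
proof (induction n arbitrary: t x)
  case 0
  then show ?case using base by simp
next
  case (Suc n)
  let ?a = "chain E \<phi> n" and ?b = "(markov_op E ^^ n) \<psi>"
  have "(radial_op E ^^ Suc n) (\<lambda>_. 1) (of_real x)
     = (\<integral>\<^sup>+q. ennreal (sqrt (sqrt 2 / \<bar>q - x\<bar>)) * (radial_op E ^^ n) (\<lambda>_. 1) (of_real (E + 2 / (q - x))) \<partial>nu)"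
    by (simp add: radial_op_def flip: of_real_diff)
  also have "\<dots> \<le> (\<integral>\<^sup>+q. ennreal (t / 2) * inv_op E ?a (q - x) + ennreal (1 / (2 * t)) * ?b (E + 2 / (q - x)) \<partial>nu)"
  proof (rule nn_integral_mono)
    fix q :: real
    let ?k = "sqrt 2 / \<bar>q - x\<bar>" and ?y = "E + 2 / (q - x)"
    show "ennreal (sqrt ?k) * (radial_op E ^^ n) (\<lambda>_. 1) (of_real ?y)
       \<le> ennreal (t / 2) * inv_op E ?a (q - x) + ennreal (1 / (2 * t)) * ?b ?y"
    proof (cases "q = x")
      case False
      define s where "s = sqrt ?k"
      have s: "0 < s" "s * s = ?k" using False by (auto simp: s_def)
      have "ennreal s * (radial_op E ^^ n) (\<lambda>_. 1) (of_real ?y)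
        \<le> ennreal s * (ennreal (t * s / 2) * ?a ?y + ennreal (1 / (2 * (t * s))) * ?b ?y)"
        using Suc s by (intro mult_left_mono Suc.IH) auto
      also have "\<dots> = ennreal (s * (t * s / 2)) * ?a ?y + ennreal (s * (1 / (2 * (t * s)))) * ?b ?y"
        using Suc.prems s by (simp only: distrib_left ennreal_mult mult.assoc less_imp_le mult_pos_pos zero_less_numeral divide_pos_pos zero_less_one)
      also have "s * (t * s / 2) = t / 2 * (s * s)" by simp
      also have "ennreal (t / 2 * (s * s)) = ennreal (t / 2) * ennreal ?k"
        unfolding s(2) using Suc.prems by (intro ennreal_mult) auto
      also have "s * (1 / (2 * (t * s))) = 1 / (2 * t)" using s by simp
      finally show ?thesis by (simp only: s_def inv_op_def mult.assoc)
    qed simp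
  qed
  also have "\<dots> = ennreal (t / 2) * chain E \<phi> (Suc n) x + ennreal (1 / (2 * t)) * (markov_op E ^^ Suc n) \<psi> x"
    by (subst nn_integral_add) (auto simp: nn_integral_cmult chain_Suc avg_def markov_op_def)
  finally show ?case .
qed

text \<open>The exponent 3/4 must exceed 1/2, for the square of this weight to be integrable at
  infinity, and stay below 1, for the reciprocal weight to have a finite mean after one Markov step.
  Inversion turns the tail \<open>\<bar>x\<bar> powr - (3/2)\<close> into an integrable singularity
  of order 1/2 at the origin.\<close>

lemma nn_integral_weight_finite:
  "(\<integral>\<^sup>+x. (ennreal (1 / max 1 (\<bar>x - E\<bar> powr (3/4))))\<^sup>2 \<partial>lborel) < \<infinity>"
proof -
  let ?h = "\<lambda>x::real. ennreal (\<bar>x\<bar> powr - (1/2)) * indicator {-1..1} x"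
  have "(\<integral>\<^sup>+x. (ennreal (1 / max 1 (\<bar>x - E\<bar> powr (3/4))))\<^sup>2 \<partial>lborel)
      = (\<integral>\<^sup>+x. (ennreal (1 / max 1 (\<bar>x\<bar> powr (3/4))))\<^sup>2 \<partial>lborel)"
    using nn_integral_real_affine[of "\<lambda>x. (ennreal (1 / max 1 (\<bar>x - E\<bar> powr (3/4))))\<^sup>2" 1 E] by simp
  also have "\<dots> \<le> (\<integral>\<^sup>+x. indicator {-2..2} x + ?h (2 / x) * ennreal (2 / x\<^sup>2) \<partial>lborel)"
  proof (rule nn_integral_mono)
    fix x :: real
    have le1: "(ennreal (1 / max 1 (\<bar>x\<bar> powr (3/4))))\<^sup>2 \<le> 1"
      by (subst ennreal_power) (auto simp: power_le_one_iff)
    show "(ennreal (1 / max 1 (\<bar>x\<bar> powr (3/4))))\<^sup>2 \<le> indicator {-2..2} x + ?h (2 / x) * ennreal (2 / x\<^sup>2)"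
    proof (cases "x \<in> {-2..2}")
      case True
      then show ?thesis using le1 by (simp add: add_increasing2)
    next
      case False
      then have ind: "indicator {-2..2} x = (0 :: ennreal)" by simp
      have x: "2 < \<bar>x\<bar>" using False by auto
      have "(1 / max 1 (\<bar>x\<bar> powr (3/4)))\<^sup>2 \<le> (1 / \<bar>x\<bar> powr (3/4))\<^sup>2"
        using x by (intro power_mono divide_left_mono) auto
      also have "\<dots> = \<bar>x\<bar> powr - (3/2)"
      proof -
        have "(\<bar>x\<bar> powr (3/4))\<^sup>2 = \<bar>x\<bar> powr (3/4 + 3/4)"
          unfolding powr_add power2_eq_square ..
        then show ?thesis by (simp add: power_divide powr_minus_divide)
      qed
      also have "\<dots> = \<bar>x\<bar> powr (1/2) * \<bar>x\<bar> powr - 2"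
        by (simp flip: powr_add)
      also have "\<bar>x\<bar> powr - 2 = 1 / x\<^sup>2"
        using x by (simp add: powr_minus_divide)
      also have "\<bar>x\<bar> powr (1/2) * (1 / x\<^sup>2) \<le> \<bar>2 / x\<bar> powr - (1/2) * (2 / x\<^sup>2)"
      proof -
        have "\<bar>2 / x\<bar> powr - (1/2) = sqrt \<bar>x\<bar> / sqrt 2"
          using x by (simp add: powr_minus_divide powr_half_sqrt abs_divide real_sqrt_divide)
        moreover have "1 \<le> 2 / sqrt 2" by (simp add: real_div_sqrt)
        then have "sqrt \<bar>x\<bar> * (1 / x\<^sup>2) * 1 \<le> sqrt \<bar>x\<bar> * (1 / x\<^sup>2) * (2 / sqrt 2)"
          by (intro mult_left_mono) auto
        ultimately show ?thesis by (simp add: powr_half_sqrt mult.commute)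
      qed
      finally have "(1 / max 1 (\<bar>x\<bar> powr (3/4)))\<^sup>2 \<le> \<bar>2 / x\<bar> powr - (1/2) * (2 / x\<^sup>2)" .
      then have "(ennreal (1 / max 1 (\<bar>x\<bar> powr (3/4))))\<^sup>2 \<le> ennreal (\<bar>2 / x\<bar> powr - (1/2) * (2 / x\<^sup>2))"
        by (subst ennreal_power) (auto intro: ennreal_leI)
      moreover have "2 / x \<in> {-1..1}"
      proof -
        have "\<bar>2 / x\<bar> \<le> 1" using x by (simp add: abs_divide)
        then show ?thesis unfolding abs_le_iff atLeastAtMost_iff by linarith
      qed
      moreover have "ennreal (\<bar>2 / x\<bar> powr - (1/2) * (2 / x\<^sup>2)) = ennreal (\<bar>2 / x\<bar> powr - (1/2)) * ennreal (2 / x\<^sup>2)"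
        by (rule ennreal_mult) auto
      ultimately show ?thesis by (simp only: indicator_simps ind add_0 mult_1_right)
    qed
  qed
  also have "\<dots> = (\<integral>\<^sup>+x. indicator {-2..2::real} x \<partial>lborel) + (\<integral>\<^sup>+x. ?h (2 / x) * ennreal (2 / x\<^sup>2) \<partial>(lborel :: real measure))"
    by (subst nn_integral_add) auto
  also have "\<dots> \<le> ennreal 4 + (\<integral>\<^sup>+x. ?h x \<partial>lborel)"
    by (intro add_mono nn_integral_inversion) auto
  also have "\<dots> \<le> ennreal 4 + ennreal (2 * 1 powr (1 - 1/2) / (1 - 1/2))"
    by (intro add_left_mono nn_integral_powr_ball) auto
  also have "\<dots> < \<infinity>" by simp
  finally show ?thesis .
qed

text \<open>One step forgets how far out the chain started, because the 3/4 moment of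
  \<open>2 / (q - x)\<close> is bounded uniformly in \<open>x\<close>; a Markov operator then
  preserves the constant. For \<open>n = 0\<close> the function is unbounded. The constant is
  \<open>1 + 2 * (1 + 2 * B / (1 - 3/4))\<close>, with 2 dominating
  \<open>2 powr (3/4)\<close>.\<close>

lemma markov_op_iterate_bound:
  assumes C: "C = 3 + 16 * B" and n: "0 < n"
  shows "(markov_op E ^^ n) (\<lambda>x. ennreal (max 1 (\<bar>x - E\<bar> powr (3/4)))) x \<le> ennreal C"
  using n
proof (induction n arbitrary: x rule: nat_induct_non_zero)
  case 1
  have "markov_op E (\<lambda>x. ennreal (max 1 (\<bar>x - E\<bar> powr (3/4)))) x \<le> (\<integral>\<^sup>+q. 1 + 2 * ennreal (\<bar>q - x\<bar> powr - (3/4)) \<partial>nu)"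
    unfolding markov_op_def
  proof (rule nn_integral_mono)
    fix q
    have "\<bar>2 / (q - x)\<bar> powr (3/4) = 2 powr (3/4) * \<bar>q - x\<bar> powr - (3/4)"
      by (simp add: abs_divide powr_divide powr_minus_divide)
    also have "(2::real) powr (3/4) \<le> 2 powr 1" by (rule powr_mono) auto
    finally have "max 1 (\<bar>2 / (q - x)\<bar> powr (3/4)) \<le> 1 + 2 * \<bar>q - x\<bar> powr - (3/4)"
      by (simp add: mult_right_mono add_increasing)
    then have "ennreal (max 1 (\<bar>2 / (q - x)\<bar> powr (3/4))) \<le> ennreal (1 + 2 * \<bar>q - x\<bar> powr - (3/4))"
      by (rule ennreal_leI)
    also have "\<dots> = 1 + 2 * ennreal (\<bar>q - x\<bar> powr - (3/4))"
      by (simp add: ennreal_mult)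
    finally show "ennreal (max 1 (\<bar>E + 2 / (q - x) - E\<bar> powr (3/4))) \<le> 1 + 2 * ennreal (\<bar>q - x\<bar> powr - (3/4))"
      by simp
  qed
  also have "\<dots> = 1 + 2 * (\<integral>\<^sup>+q. ennreal (\<bar>q - x\<bar> powr - (3/4)) \<partial>nu)"
    by (subst nn_integral_add) (auto simp: nn_integral_cmult nu.emeasure_space_1[simplified])
  also have "\<dots> \<le> 1 + 2 * ennreal (1 + 2 * B / (1 - 3/4))"
    by (intro add_left_mono mult_left_mono moment) auto
  also have "\<dots> = ennreal C"
  proof -
    have nn: "0 \<le> 1 + 2 * B / (1 - 3/4)" "0 \<le> 2 * (1 + 2 * B / (1 - 3/4))"
      using B_nonneg by auto
    have "ennreal 1 + ennreal 2 * ennreal (1 + 2 * B / (1 - 3/4)) = ennreal C"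
      unfolding C using nn
      by (simp only: ennreal_mult[symmetric] ennreal_plus[symmetric] zero_le_numeral zero_le_one)
         (simp add: algebra_simps)
    then show ?thesis by simp
  qed
  finally show ?case by simp
next
  case (Suc n)
  have "(markov_op E ^^ Suc n) (\<lambda>x. ennreal (max 1 (\<bar>x - E\<bar> powr (3/4)))) x \<le> (\<integral>\<^sup>+q. ennreal C \<partial>nu)"
    unfolding funpow.simps comp_apply by (subst markov_op_def) (intro nn_integral_mono Suc.IH)
  also have "\<dots> = ennreal C" by (simp add: nu.emeasure_space_1[simplified])
  finally show ?case .
qed

lemma radial_op_iterate_real_small:
  obtains N where "\<And>x::real. (radial_op E ^^ N) (\<lambda>_. 1) (of_real x) \<le> ennreal (1/2)"
proof -
  let ?p = "\<lambda>x. max 1 (\<bar>x - E\<bar> powr (3/4))"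
  define \<phi> where "\<phi> x = ennreal (1 / ?p x)" for x
  define \<psi> where "\<psi> x = ennreal (?p x)" for x
  have [measurable]: "\<phi> \<in> borel_measurable borel" "\<psi> \<in> borel_measurable borel"
    unfolding \<phi>_def \<psi>_def by measurable
  define C where "C = 3 + 16 * B"
  \<comment> \<open>This makes the Markov term \<open>C / (2 * t)\<close> equal to 1/4. Only
    afterwards is \<open>n\<close> chosen, so large that the L2 term is at most 1/4 as well.\<close>
  define t where "t = 2 * C"
  have t: "0 < t" "0 < C" using B_nonneg by (auto simp: t_def C_def)
  have base: "1 \<le> ennreal (t / 2) * \<phi> x + ennreal (1 / (2 * t)) * \<psi> x" if t: "0 < t" for t x
  proof -
    have p: "1 \<le> ?p x" by simp
    have "0 \<le> (t - ?p x)\<^sup>2 / (2 * t * ?p x)" using t p by (intro divide_nonneg_nonneg) auto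
    also have "\<dots> = t / 2 * (1 / ?p x) + 1 / (2 * t) * ?p x - 1"
      using t p by (simp add: field_simps power2_eq_square)
    finally have "ennreal 1 \<le> ennreal (t / 2 * (1 / ?p x) + 1 / (2 * t) * ?p x)"
      by (intro ennreal_leI) simp
    also have "\<dots> = ennreal (t / 2) * \<phi> x + ennreal (1 / (2 * t)) * \<psi> x"
    proof -
      have "0 \<le> t / 2" "0 \<le> 1 / ?p x" "0 \<le> 1 / (2 * t)" "0 \<le> ?p x" using t p by auto
      then show ?thesis
        by (simp only: \<phi>_def \<psi>_def ennreal_plus ennreal_mult mult_nonneg_nonneg)
    qed
    finally show ?thesis by simp
  qed
  have "(\<integral>\<^sup>+t. (inv_op E \<phi> t)\<^sup>2 \<partial>lborel) \<le> (\<integral>\<^sup>+x. (\<phi> x)\<^sup>2 \<partial>lborel)"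
    by (rule inv_op_L2) simp
  also have "\<dots> < \<infinity>" unfolding \<phi>_def by (rule nn_integral_weight_finite)
  finally have fin: "(\<integral>\<^sup>+t. (inv_op E \<phi> t)\<^sup>2 \<partial>lborel) < \<infinity>" .
  obtain n where n: "0 < n" "\<And>x. chain E \<phi> n x \<le> ennreal (1 / (2 * t))"
    using chain_tendsto_0[OF _ fin, of "1 / (2 * t)"] t by auto
  have "(radial_op E ^^ n) (\<lambda>_. 1) (of_real x) \<le> ennreal (1/2)" for x
  proof -
    have "(radial_op E ^^ n) (\<lambda>_. 1) (of_real x) \<le> ennreal (t / 2) * chain E \<phi> n x + ennreal (1 / (2 * t)) * (markov_op E ^^ n) \<psi> x"
      using base t by (intro radial_op_iterate_amgm) auto
    also have "\<dots> \<le> ennreal (t / 2) * ennreal (1 / (2 * t)) + ennreal (1 / (2 * t)) * ennreal C"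
      unfolding \<psi>_def by (intro add_mono mult_left_mono n markov_op_iterate_bound C_def) auto
    also have "\<dots> = ennreal (t / 2 * (1 / (2 * t)) + 1 / (2 * t) * C)"
    proof -
      have "0 \<le> t / 2" "0 \<le> 1 / (2 * t)" "0 \<le> C" using t by auto
      then show ?thesis by (simp only: ennreal_plus ennreal_mult mult_nonneg_nonneg)
    qed
    also have "t / 2 * (1 / (2 * t)) + 1 / (2 * t) * C = 1/2"
      using t by (simp add: t_def)
    finally show ?thesis .
  qed
  then show ?thesis using that by blast
qed

text \<open>Up to a constant, the product of the step weights starting from \<open>X\<close> is \<open>\<bar>\<alpha> - \<beta> X\<bar>\<close> to the power
  \<open>-1/2\<close> with real \<open>\<alpha>\<close>, \<open>\<beta>\<close>, so it can only grow when \<open>X\<close> is replaced by its real part. This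
  reduces complex \<open>X\<close> to real ones.\<close>

fun transfer_moment :: "real \<Rightarrow> nat \<Rightarrow> real \<Rightarrow> real \<Rightarrow> complex \<Rightarrow> ennreal" where
  "transfer_moment E 0 a b X = inverse (ennreal (sqrt (cmod (of_real a - of_real b * X))))"
| "transfer_moment E (Suc n) a b X = (\<integral>\<^sup>+q. ennreal (sqrt (sqrt 2)) * transfer_moment E n ((a - b * E) * q - 2 * b) (a - b * E) X \<partial>nu)"

lemma measurable_transfer_moment_triple:
  "(\<lambda>(a, b, X). transfer_moment E n a b X) \<in> borel_measurable (borel \<Otimes>\<^sub>M borel \<Otimes>\<^sub>M borel)"
proof (induction n)
  case (Suc n)
  note [measurable] = Suc.IH
  have "(\<lambda>p. (\<lambda>(a, b, X). transfer_moment E n a b X)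
      ((fst (fst p) - fst (snd (fst p)) * E) * snd p - 2 * fst (snd (fst p)),
       fst (fst p) - fst (snd (fst p)) * E, snd (snd (fst p))))
    \<in> borel_measurable ((borel \<Otimes>\<^sub>M borel \<Otimes>\<^sub>M borel) \<Otimes>\<^sub>M nu)"
    by measurable
  then have [measurable]: "(\<lambda>(x, q). transfer_moment E n ((fst x - fst (snd x) * E) * q - 2 * fst (snd x))
      (fst x - fst (snd x) * E) (snd (snd x)))
    \<in> borel_measurable ((borel \<Otimes>\<^sub>M borel \<Otimes>\<^sub>M borel) \<Otimes>\<^sub>M nu)"
    by (simp add: case_prod_unfold)
  show ?case unfolding transfer_moment.simps case_prod_unfold by measurable
qed (simp add: case_prod_unfold)

lemma measurable_transfer_moment [measurable]:
  assumes [measurable]: "a \<in> borel_measurable M" "b \<in> borel_measurable M" "X \<in> borel_measurable M"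
  shows "(\<lambda>x. transfer_moment E n (a x) (b x) (X x)) \<in> borel_measurable M"
proof -
  note [measurable] = measurable_transfer_moment_triple
  have "(\<lambda>x. (\<lambda>(a, b, X). transfer_moment E n a b X) (a x, b x, X x)) \<in> borel_measurable M"
    by measurable
  then show ?thesis by simp
qed

lemma transfer_moment_le_Re: "transfer_moment E n a b X \<le> transfer_moment E n a b (of_real (Re X))"
proof (induction n arbitrary: a b)
  case 0
  have "complex_of_real a - of_real b * of_real (Re X) = of_real (Re (of_real a - of_real b * X))" by simp
  then show ?case
    by (simp only: transfer_moment.simps norm_of_real)
       (intro ennreal_inverse_antimono ennreal_leI real_sqrt_le_mono abs_Re_le_cmod)
next
  case (Suc n)
  then show ?case by (auto intro!: nn_integral_mono mult_left_mono)
qed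

text \<open>With \<open>d = q - X\<close>, the form \<open>a - b * (E + 2 / d)\<close> equals
  \<open>((a - b * E) * d - 2 * b) / d\<close>. The step weight cancels the denominator, which
  leaves a linear form in the unchanged \<open>X\<close> with new real coefficients.\<close>

lemma radial_op_transfer_moment: "radial_op E (transfer_moment E n a b) X = transfer_moment E (Suc n) a b X"
proof (induction n arbitrary: a b)
  case 0
  have "AE q in nu. ennreal (sqrt (sqrt 2 / cmod (of_real q - X))) * transfer_moment E 0 a b (of_real E + 2 / (of_real q - X))
     = ennreal (sqrt (sqrt 2)) * transfer_moment E 0 ((a - b * E) * q - 2 * b) (a - b * E) X"
    using AE_nu_neq[of "Re X"]
  proof eventually_elim
    case (elim q)
    define d where "d = of_real q - X"
    have d: "d \<noteq> 0" using elim by (auto simp: d_def complex_eq_iff)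
    define w where "w = of_real ((a - b * E) * q - 2 * b) - of_real (a - b * E) * X"
    have "of_real a - of_real b * (of_real E + 2 / d) = w / d"
      using d by (simp add: w_def d_def field_simps)
    then have "ennreal (sqrt (sqrt 2 / cmod d)) * transfer_moment E 0 a b (of_real E + 2 / d)
        = ennreal (sqrt (sqrt 2) / sqrt (cmod d)) * inverse (ennreal (sqrt (cmod w) / sqrt (cmod d)))"
      by (simp add: norm_divide real_sqrt_divide)
    also have "\<dots> = ennreal (sqrt (sqrt 2)) * inverse (ennreal (sqrt (cmod w)))"
    proof (cases "w = 0")
      case True
      then show ?thesis using d by (simp add: ennreal_mult_top)
    next
      case False
      then show ?thesis using d by (simp add: inverse_ennreal ennreal_mult[symmetric]) (simp add: field_simps)
    qed
    finally show ?case by (simp add: d_def w_def)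
  qed
  then show ?case unfolding radial_op_def transfer_moment.simps(2) by (intro nn_integral_cong_AE)
next
  case (Suc n)
  interpret P: pair_sigma_finite nu nu ..
  let ?k = "\<lambda>q. ennreal (sqrt (sqrt 2 / cmod (of_real q - X)))" and ?c = "ennreal (sqrt (sqrt 2))"
  have "radial_op E (transfer_moment E (Suc n) a b) X = (\<integral>\<^sup>+q. \<integral>\<^sup>+r. ?k q * (?c * transfer_moment E n ((a - b * E) * r - 2 * b) (a - b * E) (of_real E + 2 / (of_real q - X))) \<partial>nu \<partial>nu)"
    unfolding radial_op_def transfer_moment.simps by (subst nn_integral_cmult) auto
  \<comment> \<open>Here \<open>r\<close> belongs to the last step of the chain and \<open>q\<close>
    to the first: \<open>transfer_moment\<close> integrates the last step outermost,
    \<open>radial_op\<close> the first.\<close>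
  also have "\<dots> = (\<integral>\<^sup>+r. \<integral>\<^sup>+q. ?k q * (?c * transfer_moment E n ((a - b * E) * r - 2 * b) (a - b * E) (of_real E + 2 / (of_real q - X))) \<partial>nu \<partial>nu)"
    by (rule P.Fubini') measurable
  also have "\<dots> = (\<integral>\<^sup>+r. ?c * radial_op E (transfer_moment E n ((a - b * E) * r - 2 * b) (a - b * E)) X \<partial>nu)"
    unfolding radial_op_def by (simp add: mult.left_commute[of _ ?c] nn_integral_cmult)
  also have "\<dots> = transfer_moment E (Suc (Suc n)) a b X"
    unfolding Suc.IH by (simp only: transfer_moment.simps)
  finally show ?case .
qed

lemma radial_op_iterate_eq_transfer_moment: "(radial_op E ^^ n) (\<lambda>_. 1) = transfer_moment E n 1 0"
proof (induction n)
  case (Suc n)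
  then show ?case by (simp only: funpow.simps comp_apply) (rule ext, rule radial_op_transfer_moment)
qed (simp add: fun_eq_iff)

lemma radial_op_iterate_small:
  obtains N where "\<And>X. (radial_op E ^^ N) (\<lambda>_. 1) X \<le> ennreal (1/2)"
proof -
  obtain N where "\<And>x::real. (radial_op E ^^ N) (\<lambda>_. 1) (of_real x) \<le> ennreal (1/2)"
    by (rule radial_op_iterate_real_small) (rule that)
  then show ?thesis using that[of N] transfer_moment_le_Re order_trans unfolding radial_op_iterate_eq_transfer_moment by blast
qed

end

section \<open>Perturbation in the transversal coupling and the energy\<close>

definition step_weight :: "(complex \<Rightarrow> real) \<Rightarrow> complex \<Rightarrow> complex \<Rightarrow> complex \<Rightarrow> real" where
  "step_weight f z v w = sqrt (norm (1 / v, 1 / w)) * f (z + 1 / v + 1 / w)"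

lemma measurable_step_weight [measurable]:
  assumes [measurable]: "f \<in> borel_measurable borel" "v \<in> borel_measurable M" "w \<in> borel_measurable M"
  shows "(\<lambda>x. step_weight f z (v x) (w x)) \<in> borel_measurable M"
  unfolding step_weight_def norm_Pair by measurable

lemma step_weight_nonneg: "(\<And>X. 0 \<le> f X) \<Longrightarrow> 0 \<le> step_weight f z v w"
  by (simp add: step_weight_def)

text \<open>Passing to real parts leaves singularities in the real potential alone, whose integrals
  are bounded uniformly in all complex parameters.\<close>

lemma step_weight_le:
  assumes "\<And>X. 0 \<le> f X" "\<And>X. f X \<le> M" "Re v \<noteq> 0" "Re w \<noteq> 0"
  shows "step_weight f z v w \<le> M * (\<bar>Re v\<bar> powr - (1/2) + \<bar>Re w\<bar> powr - (1/2))"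
proof -
  have M: "0 \<le> M" using assms(1,2) order_trans by blast
  have *: "sqrt (cmod (1 / v)) \<le> \<bar>Re v\<bar> powr - (1/2)" if "Re v \<noteq> 0" for v
  proof -
    have "cmod (1 / v) \<le> 1 / \<bar>Re v\<bar>"
      using that abs_Re_le_cmod[of v] by (simp add: norm_divide frac_le)
    then have "sqrt (cmod (1 / v)) \<le> sqrt (1 / \<bar>Re v\<bar>)" by simp
    also have "\<dots> = \<bar>Re v\<bar> powr - (1/2)"
      by (simp add: powr_minus_divide powr_half_sqrt real_sqrt_divide)
    finally show ?thesis .
  qed
  have "sqrt (norm (1 / v, 1 / w)) \<le> sqrt (cmod (1 / v) + cmod (1 / w))"
    by (simp add: norm_Pair_le)
  also have "\<dots> \<le> sqrt (cmod (1 / v)) + sqrt (cmod (1 / w))"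
    by (rule sqrt_add_le_add_sqrt) auto
  also have "\<dots> \<le> \<bar>Re v\<bar> powr - (1/2) + \<bar>Re w\<bar> powr - (1/2)"
    using assms by (intro add_mono *) auto
  finally have "sqrt (norm (1 / v, 1 / w)) \<le> \<bar>Re v\<bar> powr - (1/2) + \<bar>Re w\<bar> powr - (1/2)" .
  then have "step_weight f z v w \<le> (\<bar>Re v\<bar> powr - (1/2) + \<bar>Re w\<bar> powr - (1/2)) * M"
    unfolding step_weight_def using assms by (intro mult_mono) auto
  then show ?thesis by (simp add: mult.commute)
qed

lemma step_weight_uniform:
  assumes f: "\<And>X. 0 \<le> f X" "\<And>X. f X \<le> M" "uniformly_continuous_on UNIV f"
    and r: "0 < r" and d: "0 < d"
  obtains h where "0 < h"
    "\<And>u v w z z'. r \<le> cmod u \<Longrightarrow> cmod (v - u) \<le> h \<Longrightarrow> cmod (w - u) \<le> h \<Longrightarrow> cmod (z - z') \<le> h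
      \<Longrightarrow> step_weight f z v w \<le> step_weight f z' u u + d"
proof -
  define A where "A = sqrt (2 / r)"
  have A: "0 < A" using r by (simp add: A_def)
  obtain e where e: "0 < e" "\<And>x y. dist x y < e \<Longrightarrow> dist (f x) (f y) < d / (2 * A)"
    using f(3) d A unfolding uniformly_continuous_on_def by (metis UNIV_I divide_pos_pos mult_pos_pos zero_less_numeral)
  have l1: "((\<lambda>h. sqrt (4 * h / r\<^sup>2) * M) \<longlongrightarrow> sqrt (4 * 0 / r\<^sup>2) * M) (at_right 0)"
    by (intro tendsto_intros) (use r in auto)
  have l2: "((\<lambda>h. h + 4 * h / r\<^sup>2) \<longlongrightarrow> 0 + 4 * 0 / r\<^sup>2) (at_right 0)"
    by (intro tendsto_intros) (use r in auto)
  \<comment> \<open>With \<open>h < r / 2\<close> the moved denominators stay at least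
    \<open>r / 2\<close> in modulus, so each reciprocal moves by at most \<open>2 * h / r^2\<close>.
    The first condition keeps the error of the weight below \<open>d / 2\<close>, the second does so
    for the error of \<open>f\<close>, since the unperturbed weight is at most
    \<open>A\<close>.\<close>
  have "eventually (\<lambda>h. sqrt (4 * h / r\<^sup>2) * M < d / 2 \<and> h + 4 * h / r\<^sup>2 < e \<and> h < r / 2 \<and> 0 < h) (at_right 0)"
    using order_tendstoD(2)[OF l1, of "d/2"] order_tendstoD(2)[OF l2, of e] d e(1) r
      eventually_at_right_less[of "0::real"] eventually_at_right_real[of 0 "r/2"]
    by (auto intro!: eventually_conj elim: eventually_mono)
  then obtain h where h: "sqrt (4 * h / r\<^sup>2) * M < d / 2" "h + 4 * h / r\<^sup>2 < e" "h < r / 2" "0 < h"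
    using eventually_happens' trivial_limit_at_right_real by (metis (no_types, lifting))
  show ?thesis
  proof (rule that[OF h(4)])
    fix u v w z z'
    assume u: "r \<le> cmod u" and v: "cmod (v - u) \<le> h" and w: "cmod (w - u) \<le> h" and z: "cmod (z - z') \<le> h"
    have inv: "cmod (1 / v - 1 / u) \<le> 2 * h / r\<^sup>2" if v: "cmod (v - u) \<le> h" for v
    proof -
      have "cmod u \<le> cmod (v - u) + cmod v" by (metis norm_minus_commute norm_triangle_sub add.commute)
      then have vb: "r / 2 \<le> cmod v" using u v h by linarith
      have nz: "u \<noteq> 0" "v \<noteq> 0" using vb u r by auto
      have "cmod (1 / v - 1 / u) = cmod (v - u) / (cmod u * cmod v)"
        using nz by (simp add: diff_frac_eq norm_divide norm_mult norm_minus_commute mult.commute)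
      also have "\<dots> \<le> h / (r * (r / 2))"
        using u v vb r h by (intro frac_le mult_mono) auto
      finally show ?thesis by (simp add: power2_eq_square field_simps)
    qed
    define s where "s = sqrt (norm (1 / u, 1 / u))"
    have "norm (1 / v, 1 / w) \<le> norm (1 / u, 1 / u) + norm ((1 / v, 1 / w) - (1 / u, 1 / u))"
      by (rule norm_triangle_sub)
    also have "norm ((1 / v, 1 / w) - (1 / u, 1 / u)) \<le> 2 * h / r\<^sup>2 + 2 * h / r\<^sup>2"
      using inv[OF v] inv[OF w] norm_Pair_le[of "1/v - 1/u" "1/w - 1/u"] by simp
    finally have "sqrt (norm (1 / v, 1 / w)) \<le> sqrt (norm (1 / u, 1 / u) + 4 * h / r\<^sup>2)" by simp
    also have "\<dots> \<le> s + sqrt (4 * h / r\<^sup>2)"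
      unfolding s_def using h by (intro sqrt_add_le_add_sqrt) auto
    finally have s1: "sqrt (norm (1 / v, 1 / w)) \<le> s + sqrt (4 * h / r\<^sup>2)" .
    have "norm (1 / u, 1 / u) \<le> 1 / cmod u + 1 / cmod u"
      using norm_Pair_le[of "1/u" "1/u"] by (simp add: norm_divide)
    also have "\<dots> \<le> 1 / r + 1 / r" using u r by (intro add_mono divide_left_mono mult_pos_pos) auto
    finally have sA: "s \<le> A" unfolding s_def A_def by simp
    have "(z + 1 / v + 1 / w) - (z' + 1 / u + 1 / u) = (z - z') + (1 / v - 1 / u) + (1 / w - 1 / u)" by simp
    then have "cmod ((z + 1 / v + 1 / w) - (z' + 1 / u + 1 / u)) \<le> h + 2 * h / r\<^sup>2 + 2 * h / r\<^sup>2"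
      using z inv[OF v] inv[OF w] by (smt (verit) norm_triangle_ineq)
    then have "dist (z + 1 / v + 1 / w) (z' + 1 / u + 1 / u) < e"
      using h(2) by (simp add: dist_norm)
    then have f1: "f (z + 1 / v + 1 / w) \<le> f (z' + 1 / u + 1 / u) + d / (2 * A)"
      using e(2) by (fastforce simp: dist_real_def)
    have s0: "0 \<le> s" by (simp add: s_def)
    have "step_weight f z v w \<le> (s + sqrt (4 * h / r\<^sup>2)) * f (z + 1 / v + 1 / w)"
      unfolding step_weight_def by (intro mult_right_mono s1 f)
    also have "\<dots> = s * f (z + 1 / v + 1 / w) + sqrt (4 * h / r\<^sup>2) * f (z + 1 / v + 1 / w)"
      by (simp add: distrib_right)
    also have "s * f (z + 1 / v + 1 / w) \<le> s * (f (z' + 1 / u + 1 / u) + d / (2 * A))"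
      by (intro mult_left_mono f1 s0)
    also have "s * (f (z' + 1 / u + 1 / u) + d / (2 * A)) = step_weight f z' u u + s * (d / (2 * A))"
      by (simp add: step_weight_def s_def distrib_left)
    also have "s * (d / (2 * A)) \<le> A * (d / (2 * A))"
      using sA d A by (intro mult_right_mono) auto
    also have "A * (d / (2 * A)) = d / 2" using A by simp
    also have "sqrt (4 * h / r\<^sup>2) * f (z + 1 / v + 1 / w) \<le> sqrt (4 * h / r\<^sup>2) * M"
      using h by (intro mult_left_mono f) auto
    also have "\<dots> \<le> d / 2" using h by simp
    finally show "step_weight f z v w \<le> step_weight f z' u u + d" by simp
  qed
qed

lemma uniformly_continuous_on_sum:
  fixes f :: "'i \<Rightarrow> 'a::metric_space \<Rightarrow> 'b::real_normed_vector"
  assumes "\<And>i. i \<in> I \<Longrightarrow> uniformly_continuous_on S (f i)"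
  shows "uniformly_continuous_on S (\<lambda>x. \<Sum>i\<in>I. f i x)"
  using assms
  by (induction I rule: infinite_finite_induct)
     (auto intro: uniformly_continuous_on_add uniformly_continuous_on_const)

section \<open>The transfer operator with transversal disorder\<close>

locale anderson_tree = bounded_density +
  fixes sig :: "(real \<times> real) measure"
  assumes prob_space_sig: "prob_space sig" and sets_sig [measurable_cong, simp]: "sets sig = sets borel"
    and sig_support: "emeasure sig ({-1..1} \<times> {-1..1}) = 1"
begin

sublocale sig: prob_space sig by (rule prob_space_sig)

lemma space_sig [simp]: "space sig = UNIV"
  using sets_eq_imp_space_eq[OF sets_sig] by simp

lemma AE_sig: "AE p in sig. \<bar>fst p\<bar> \<le> 1 \<and> \<bar>snd p\<bar> \<le> 1"
proof -
  have "AE p in sig. p \<in> {-1..1} \<times> {-1..1}"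
    using sig_support by (intro sig.AE_prob_1) (simp add: sig.emeasure_eq_measure)
  then show ?thesis by eventually_elim auto
qed

definition transfer_op :: "real \<Rightarrow> complex \<Rightarrow> (complex \<Rightarrow> real) \<Rightarrow> complex \<Rightarrow> ennreal" where
  "transfer_op k z f X = (\<integral>\<^sup>+p. \<integral>\<^sup>+q. ennreal (step_weight f z (of_real (q + k * fst p) - X) (of_real (q + k * snd p) - X)) \<partial>nu \<partial>sig)"

lemma radial_op_eq: "radial_op E (\<lambda>X. ennreal (f X)) X
    = (\<integral>\<^sup>+q. ennreal (step_weight f (of_real E) (of_real q - X) (of_real q - X)) \<partial>nu)"
proof -
  have "norm (1 / v, 1 / v) = sqrt 2 / cmod v" for v :: complex
  proof -
    have "norm (1 / v, 1 / v) = sqrt (2 * (1 / cmod v)\<^sup>2)" by (simp add: norm_Pair norm_divide)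
    then show ?thesis by (simp add: real_sqrt_mult)
  qed
  then show ?thesis
    unfolding radial_op_def step_weight_def by (intro nn_integral_cong) (simp add: ennreal_mult' add.assoc)
qed

lemma transfer_op_0: "transfer_op 0 (of_real E) f X = radial_op E (\<lambda>X. ennreal (f X)) X"
  unfolding transfer_op_def radial_op_eq by (simp add: sig.emeasure_space_1[simplified])

text \<open>Potentials with \<open>q\<close> within \<open>r\<close> of \<open>Y\<close> are not
  compared at all: their contribution is of order \<open>sqrt r\<close>, uniformly in the
  parameters. On the rest the integrand is uniformly continuous. Separate points \<open>X\<close>
  and \<open>Y\<close> make the lemma serve twice: with \<open>X = Y\<close> it perturbs coupling
  and energy, with \<open>k = 0\<close> it is a modulus of continuity.\<close>

lemma transfer_op_compare:
  assumes f: "\<And>X. 0 \<le> f X" "\<And>X. f X \<le> M" "uniformly_continuous_on UNIV f" and d: "0 < d"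
  obtains h where "0 < h"
    "\<And>k z X Y. 0 \<le> k \<Longrightarrow> k \<le> h \<Longrightarrow> cmod (z - of_real E) \<le> h \<Longrightarrow> cmod (X - Y) \<le> h
      \<Longrightarrow> transfer_op k z f X \<le> radial_op E (\<lambda>X. ennreal (f X)) Y + ennreal d"
proof -
  have M: "0 \<le> M" using f(1,2) order_trans by blast
  have [measurable]: "f \<in> borel_measurable borel"
    using f(3) by (intro borel_measurable_continuous_onI uniformly_continuous_imp_continuous)
  define c where "c r = 2 * M * (B * (2 * (2 * r) powr (1 - 1/2) / (1 - 1/2)))" for r :: real
  have "((\<lambda>r. 8 * M * B * sqrt (2 * r)) \<longlongrightarrow> 8 * M * B * sqrt (2 * 0)) (at_right 0)"
    by (intro tendsto_intros)
  then have "eventually (\<lambda>r. 8 * M * B * sqrt (2 * r) < d / 2 \<and> 0 < r) (at_right 0)"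
    using d by (intro eventually_conj order_tendstoD(2)[where a = "d/2"] eventually_at_right_less) auto
  then obtain r where r: "8 * M * B * sqrt (2 * r) < d / 2" "0 < r"
    using eventually_happens' trivial_limit_at_right_real by (metis (no_types, lifting))
  have cr: "c r \<le> d / 2" using r by (simp add: c_def powr_half_sqrt)
  obtain h where h: "0 < h" and k: "\<And>u v w z z'. r \<le> cmod u \<Longrightarrow> cmod (v - u) \<le> h \<Longrightarrow> cmod (w - u) \<le> h \<Longrightarrow> cmod (z - z') \<le> h
      \<Longrightarrow> step_weight f z v w \<le> step_weight f z' u u + d / 2"
    by (rule step_weight_uniform[OF f r(2), of "d/2"]) (use d that in auto)
  \<comment> \<open>The coupling and the change from \<open>X\<close> to \<open>Y\<close> each shift
    a denominator by at most \<open>h'\<close>. Their sum must stay below \<open>h\<close> for the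
    uniform estimate, and below \<open>r\<close> so that singular denominators have real part within
    \<open>2 * r\<close>.\<close>
  define h' where "h' = min (h / 2) (r / 2)"
  have h': "0 < h'" "2 * h' \<le> h" "2 * h' \<le> r" using h r by (auto simp: h'_def)
  show ?thesis
  proof (rule that[OF h'(1)])
    fix k :: real and z X Y :: complex
    assume k0: "0 \<le> k" "k \<le> h'" and z: "cmod (z - of_real E) \<le> h'" and XY: "cmod (X - Y) \<le> h'"
    let ?v = "\<lambda>q s. of_real (q + k * s) - X"
    let ?b = "\<lambda>s q. ennreal (\<bar>q - (Re X - k * s)\<bar> powr - (1/2)) * indicator {-(2*r)..2*r} (q - (Re X - k * s))"
    have inner: "(\<integral>\<^sup>+q. ennreal (step_weight f z (?v q (fst p)) (?v q (snd p))) \<partial>nu)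
        \<le> radial_op E (\<lambda>X. ennreal (f X)) Y + ennreal d" if p: "\<bar>fst p\<bar> \<le> 1 \<and> \<bar>snd p\<bar> \<le> 1" for p
    proof -
      have ks: "\<bar>k * fst p\<bar> \<le> h'" "\<bar>k * snd p\<bar> \<le> h'"
        using p k0 mult_mono[of "\<bar>k\<bar>" h' "\<bar>fst p\<bar>" 1] mult_mono[of "\<bar>k\<bar>" h' "\<bar>snd p\<bar>" 1] h'
        by (auto simp: abs_mult)
      have "AE q in nu. ennreal (step_weight f z (?v q (fst p)) (?v q (snd p)))
        \<le> ennreal (step_weight f (of_real E) (of_real q - Y) (of_real q - Y)) + ennreal (d / 2)
          + ennreal M * (?b (fst p) q + ?b (snd p) q)"
        using AE_nu_neq[of "Re X - k * fst p"] AE_nu_neq[of "Re X - k * snd p"]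
      proof eventually_elim
        case (elim q)
        have close: "cmod (?v q s - (of_real q - Y)) \<le> 2 * h'" if "\<bar>k * s\<bar> \<le> h'" for s
        proof -
          have "?v q s - (of_real q - Y) = of_real (k * s) - (X - Y)" by simp
          then have "cmod (?v q s - (of_real q - Y)) \<le> cmod (of_real (k * s)) + cmod (X - Y)"
            by (simp only: norm_triangle_ineq4)
          then show ?thesis using that XY by (simp only: norm_of_real)
        qed
        show ?case
        proof (cases "r \<le> cmod (of_real q - Y)")
          case True
          have "step_weight f z (?v q (fst p)) (?v q (snd p)) \<le> step_weight f (of_real E) (of_real q - Y) (of_real q - Y) + d / 2"
            using close[OF ks(1)] close[OF ks(2)] z h' by (intro k True) auto
          then have "ennreal (step_weight f z (?v q (fst p)) (?v q (snd p)))
            \<le> ennreal (step_weight f (of_real E) (of_real q - Y) (of_real q - Y) + d / 2)"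
            by (rule ennreal_leI)
          also have "\<dots> = ennreal (step_weight f (of_real E) (of_real q - Y) (of_real q - Y)) + ennreal (d / 2)"
            using d by (intro ennreal_plus step_weight_nonneg f) auto
          finally have "ennreal (step_weight f z (?v q (fst p)) (?v q (snd p)))
            \<le> ennreal (step_weight f (of_real E) (of_real q - Y) (of_real q - Y)) + ennreal (d / 2)" .
          then show ?thesis by (rule add_increasing2[rotated]) simp
        next
          case False
          have bnd: "q - (Re X - k * s) \<in> {-(2*r)..2*r}" if "\<bar>k * s\<bar> \<le> h'" for s
          proof -
            have "\<bar>Re (?v q s - (of_real q - Y))\<bar> \<le> 2 * h'"
              using close[OF that] abs_Re_le_cmod order_trans by blast
            moreover have "\<bar>Re (of_real q - Y)\<bar> < r"
              using False abs_Re_le_cmod[of "of_real q - Y"] by linarith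
            ultimately show ?thesis using h' by (auto simp: abs_if split: if_splits)
          qed
          have "step_weight f z (?v q (fst p)) (?v q (snd p))
            \<le> M * (\<bar>Re (?v q (fst p))\<bar> powr - (1/2) + \<bar>Re (?v q (snd p))\<bar> powr - (1/2))"
            using elim by (intro step_weight_le f) auto
          then have "ennreal (step_weight f z (?v q (fst p)) (?v q (snd p)))
            \<le> ennreal (M * (\<bar>Re (?v q (fst p))\<bar> powr - (1/2) + \<bar>Re (?v q (snd p))\<bar> powr - (1/2)))"
            by (rule ennreal_leI)
          also have "\<dots> = ennreal M * (?b (fst p) q + ?b (snd p) q)"
          proof -
            have em: "ennreal (M * (a + b)) = ennreal M * (ennreal a + ennreal b)" if "0 \<le> a" "0 \<le> b" for a b
              unfolding ennreal_plus[OF that, symmetric] using M that by (intro ennreal_mult) auto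
            have "Re (?v q s) = q - (Re X - k * s)" for s by simp
            then show ?thesis
              using bnd[OF ks(1)] bnd[OF ks(2)]
              by (simp only: em[OF powr_ge_zero powr_ge_zero] indicator_simps mult_1_right)
          qed
          finally show ?thesis by (rule add_increasing[rotated]) simp
        qed
      qed
      then have "(\<integral>\<^sup>+q. ennreal (step_weight f z (?v q (fst p)) (?v q (snd p))) \<partial>nu)
        \<le> (\<integral>\<^sup>+q. ennreal (step_weight f (of_real E) (of_real q - Y) (of_real q - Y)) + ennreal (d / 2)
          + ennreal M * (?b (fst p) q + ?b (snd p) q) \<partial>nu)"
        by (rule nn_integral_mono_AE)
      also have "\<dots> = radial_op E (\<lambda>X. ennreal (f X)) Y + ennreal (d / 2)
          + ennreal M * ((\<integral>\<^sup>+q. ?b (fst p) q \<partial>nu) + (\<integral>\<^sup>+q. ?b (snd p) q \<partial>nu))"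
        unfolding radial_op_eq by (simp add: nn_integral_add nn_integral_cmult nu.emeasure_space_1[simplified])
      also have "\<dots> \<le> radial_op E (\<lambda>X. ennreal (f X)) Y + ennreal (d / 2)
          + ennreal M * (ennreal (B * (2 * (2 * r) powr (1 - 1/2) / (1 - 1/2))) + ennreal (B * (2 * (2 * r) powr (1 - 1/2) / (1 - 1/2))))"
        using r by (intro add_left_mono mult_left_mono add_mono truncated_moment) auto
      also have "ennreal M * (ennreal (B * (2 * (2 * r) powr (1 - 1/2) / (1 - 1/2))) + ennreal (B * (2 * (2 * r) powr (1 - 1/2) / (1 - 1/2)))) = ennreal (c r)"
      proof -
        have "0 \<le> B * (2 * (2 * r) powr (1 - 1/2) / (1 - 1/2))" using B_nonneg by simp
        then show ?thesis using M unfolding c_def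
          by (subst ennreal_plus[symmetric], simp, simp, subst ennreal_mult[symmetric]) (auto intro!: arg_cong[where f = ennreal])
      qed
      also have "ennreal (c r) \<le> ennreal (d / 2)" by (intro ennreal_leI cr)
      also have "radial_op E (\<lambda>X. ennreal (f X)) Y + ennreal (d / 2) + ennreal (d / 2) = radial_op E (\<lambda>X. ennreal (f X)) Y + ennreal d"
        using d by (simp add: add.assoc flip: ennreal_plus)
      finally show ?thesis by (simp add: add_left_mono)
    qed
    have "transfer_op k z f X \<le> (\<integral>\<^sup>+p. radial_op E (\<lambda>X. ennreal (f X)) Y + ennreal d \<partial>sig)"
      unfolding transfer_op_def by (rule nn_integral_mono_AE) (use AE_sig in eventually_elim, rule inner)
    also have "\<dots> = radial_op E (\<lambda>X. ennreal (f X)) Y + ennreal d"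
      by (simp add: sig.emeasure_space_1[simplified])
    finally show "transfer_op k z f X \<le> radial_op E (\<lambda>X. ennreal (f X)) Y + ennreal d" .
  qed
qed

end

section \<open>The Lyapunov function\<close>

context anderson_tree
begin

lemma radial_op_bounded:
  assumes f: "\<And>X. 0 \<le> f X" "\<And>X. f X \<le> M"
    and [measurable]: "f \<in> borel_measurable borel"
  shows "radial_op E (\<lambda>X. ennreal (f X)) Y \<le> ennreal (2 * M * (1 + 4 * B))"
proof -
  have M: "0 \<le> M" using f order_trans by blast
  have "AE q in nu. ennreal (step_weight f (of_real E) (of_real q - Y) (of_real q - Y))
      \<le> ennreal (2 * M) * ennreal (\<bar>q - Re Y\<bar> powr - (1/2))"
    using AE_nu_neq[of "Re Y"]
  proof eventually_elim
    case (elim q)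
    have "Re (of_real q - Y) \<noteq> 0" using elim by simp
    then have "step_weight f (of_real E) (of_real q - Y) (of_real q - Y)
        \<le> M * (\<bar>Re (of_real q - Y)\<bar> powr - (1/2) + \<bar>Re (of_real q - Y)\<bar> powr - (1/2))"
      by (intro step_weight_le f)
    then have "ennreal (step_weight f (of_real E) (of_real q - Y) (of_real q - Y)) \<le> ennreal (2 * M * \<bar>q - Re Y\<bar> powr - (1/2))"
      by (intro ennreal_leI) simp
    also have "\<dots> = ennreal (2 * M) * ennreal (\<bar>q - Re Y\<bar> powr - (1/2))"
      using M by (intro ennreal_mult) auto
    finally show ?case .
  qed
  then have "radial_op E (\<lambda>X. ennreal (f X)) Y \<le> (\<integral>\<^sup>+q. ennreal (2 * M) * ennreal (\<bar>q - Re Y\<bar> powr - (1/2)) \<partial>nu)"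
    unfolding radial_op_eq by (rule nn_integral_mono_AE)
  also have "\<dots> = ennreal (2 * M) * (\<integral>\<^sup>+q. ennreal (\<bar>q - Re Y\<bar> powr - (1/2)) \<partial>nu)"
    by (rule nn_integral_cmult) simp
  also have "\<dots> \<le> ennreal (2 * M) * ennreal (1 + 2 * B / (1 - 1/2))"
    by (intro mult_left_mono moment) auto
  also have "\<dots> = ennreal (2 * M * (1 + 2 * B / (1 - 1/2)))"
    using M B_nonneg by (intro ennreal_mult[symmetric]) auto
  finally show ?thesis by simp
qed

definition radial_pow :: "real \<Rightarrow> nat \<Rightarrow> complex \<Rightarrow> real" where
  "radial_pow E n X = enn2real ((radial_op E ^^ n) (\<lambda>_. 1) X)"

text \<open>Finiteness, boundedness and uniform continuity go through one induction because the
  comparison lemma consumes all of them. With zero coupling and unchanged energy it bounds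
  \<open>?g X\<close> by \<open>?g Y\<close> plus an error, and exchanging \<open>X\<close> and
  \<open>Y\<close> gives continuity of the next iterate.\<close>

lemma radial_pow:
  "(radial_op E ^^ n) (\<lambda>_. 1) = (\<lambda>X. ennreal (radial_pow E n X))
   \<and> (\<exists>M. \<forall>X. radial_pow E n X \<le> M) \<and> uniformly_continuous_on UNIV (radial_pow E n)"
proof (induction n)
  case 0
  have "radial_pow E 0 = (\<lambda>_. 1)" by (auto simp: radial_pow_def)
  then show ?case by (auto simp: uniformly_continuous_on_const)
next
  case (Suc n)
  let ?f = "radial_pow E n" and ?g = "radial_pow E (Suc n)"
  obtain M where M: "\<forall>X. ?f X \<le> M" using Suc by blast
  have f: "\<And>X. 0 \<le> ?f X" "\<And>X. ?f X \<le> M" using M by (simp_all add: radial_pow_def)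
  have uc: "uniformly_continuous_on UNIV ?f" and it: "(radial_op E ^^ n) (\<lambda>_. 1) = (\<lambda>X. ennreal (?f X))"
    using Suc by blast+
  have [measurable]: "?f \<in> borel_measurable borel"
    using uc by (intro borel_measurable_continuous_onI uniformly_continuous_imp_continuous)
  have g_def: "?g X = enn2real (radial_op E (\<lambda>X. ennreal (?f X)) X)" for X
    by (simp only: radial_pow_def[of E "Suc n"] funpow.simps comp_apply it)
  have bd: "radial_op E (\<lambda>X. ennreal (?f X)) X \<le> ennreal (2 * M * (1 + 4 * B))" for X
    by (rule radial_op_bounded) (use f in auto)
  have M: "0 \<le> 2 * M * (1 + 4 * B)" using f order_trans[OF f] B_nonneg by auto
  have g: "radial_op E (\<lambda>X. ennreal (?f X)) X = ennreal (?g X)" for X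
    unfolding g_def using le_less_trans[OF bd, of \<top> X] by simp
  have g0: "0 \<le> ?g X" for X by (simp add: g_def)
  have "?g X \<le> 2 * M * (1 + 4 * B)" for X
    using bd[of X] M unfolding g by simp
  moreover have "uniformly_continuous_on UNIV ?g"
    unfolding uniformly_continuous_on_def
  proof safe
    fix e :: real assume e: "0 < e"
    obtain h where h: "0 < h" and cmp: "\<And>k z X Y. 0 \<le> k \<Longrightarrow> k \<le> h \<Longrightarrow> cmod (z - of_real E) \<le> h \<Longrightarrow> cmod (X - Y) \<le> h
      \<Longrightarrow> transfer_op k z ?f X \<le> radial_op E (\<lambda>X. ennreal (?f X)) Y + ennreal (e / 2)"
      by (rule transfer_op_compare[OF f uc, of "e / 2" E]) (use e that in auto)
    have le: "?g X \<le> ?g Y + e / 2" if "cmod (X - Y) \<le> h" for X Y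
    proof -
      have "ennreal (?g X) \<le> ennreal (?g Y) + ennreal (e / 2)"
        using cmp[of 0 "of_real E" X Y] that h unfolding transfer_op_0 g by simp
      also have "\<dots> = ennreal (?g Y + e / 2)"
        using g0 e by (intro ennreal_plus[symmetric]) auto
      finally have "ennreal (?g X) \<le> ennreal (?g Y + e / 2)" .
      then show ?thesis using g0[of Y] e by (subst (asm) ennreal_le_iff) auto
    qed
    have "dist (?g Y) (?g X) < e" if "dist Y X < h" for X Y
      using le[of X Y] le[of Y X] that e by (auto simp: dist_norm norm_minus_commute dist_real_def abs_if)
    then show "\<exists>d>0. \<forall>x\<in>UNIV. \<forall>x'\<in>UNIV. dist x' x < d \<longrightarrow> dist (?g x') (?g x) < e"
      using h by auto
  qed
  moreover have "(radial_op E ^^ Suc n) (\<lambda>_. 1) = (\<lambda>X. ennreal (?g X))"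
    by (rule ext) (simp only: funpow.simps comp_apply it g)
  ultimately show ?case by blast
qed

text \<open>If the \<open>N\<close>-th iterate of \<open>1\<close> is at most \<open>1/2\<close>, then the sum \<open>F\<close> of the first \<open>N\<close> iterates
  satisfies \<open>radial_op F \<le> F - 1/2\<close>. As \<open>F\<close> is uniformly continuous, this strict decrease survives
  small perturbations of the parameters.\<close>

lemma lyapunov:
  obtains F M h l where "\<And>X. 1 \<le> F X" "\<And>X. F X \<le> M" "F \<in> borel_measurable borel"
    "0 < h" "0 < l" "l < 1"
    "\<And>k z X. 0 \<le> k \<Longrightarrow> k \<le> h \<Longrightarrow> cmod (z - of_real E) \<le> h \<Longrightarrow> transfer_op k z F X \<le> ennreal (l * F X)"
proof -
  obtain N where N: "\<And>X. (radial_op E ^^ N) (\<lambda>_. 1) X \<le> ennreal (1/2)"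
    by (rule radial_op_iterate_small) (rule that)
  let ?f = "radial_pow E"
  have it: "(radial_op E ^^ n) (\<lambda>_. 1) = (\<lambda>X. ennreal (?f n X))" for n using radial_pow by blast
  have f0: "0 \<le> ?f n X" for n X by (simp add: radial_pow_def)
  have f_0: "?f 0 X = 1" for X by (simp add: radial_pow_def)
  have fN: "?f N X \<le> 1/2" for X using N[of X] unfolding it by (subst (asm) ennreal_le_iff) auto
  have N0: "0 < N" using fN[of 0] f_0 by (cases N) auto
  define F where "F X = (\<Sum>n<N. ?f n X)" for X
  have F1: "1 \<le> F X" for X
    unfolding F_def f_0[symmetric, of X] by (rule member_le_sum) (use N0 f0 in auto)
  have "\<forall>n. \<exists>M. \<forall>X. ?f n X \<le> M" using radial_pow by blast
  from choice[OF this] obtain Mf where Mf: "\<And>n X. ?f n X \<le> Mf n" by blast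
  define M where "M = (\<Sum>n<N. Mf n)"
  have FM: "F X \<le> M" for X unfolding F_def M_def by (intro sum_mono Mf)
  have M1: "1 \<le> M" using F1 FM order_trans by blast
  have F0: "0 \<le> F X" for X using F1[of X] by linarith
  have uc: "uniformly_continuous_on UNIV F"
    unfolding F_def[abs_def] by (intro uniformly_continuous_on_sum) (use radial_pow in blast)
  have meas: "F \<in> borel_measurable borel"
    using uc by (intro borel_measurable_continuous_onI uniformly_continuous_imp_continuous)
  have meas_f [measurable]: "?f n \<in> borel_measurable borel" for n
    using radial_pow by (intro borel_measurable_continuous_onI uniformly_continuous_imp_continuous) blast
  have radial_F: "radial_op E (\<lambda>X. ennreal (F X)) X = ennreal (F X - 1 + ?f N X)" for X
  proof -
    have F: "ennreal (F Y) = (\<Sum>n<N. ennreal (?f n Y))" for Y by (simp add: F_def f0)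
    have "radial_op E (\<lambda>X. ennreal (F X)) X = (\<Sum>n<N. radial_op E (\<lambda>X. ennreal (?f n X)) X)"
      unfolding radial_op_def F sum_distrib_left by (rule nn_integral_sum) measurable
    also have "\<dots> = (\<Sum>n<N. ennreal (?f (Suc n) X))"
    proof (rule sum.cong)
      fix n
      show "radial_op E (\<lambda>X. ennreal (?f n X)) X = ennreal (?f (Suc n) X)"
        using fun_cong[OF it[of "Suc n"], of X] by (simp only: funpow.simps comp_apply it[of n])
    qed simp
    also have "\<dots> = ennreal (\<Sum>n<N. ?f (Suc n) X)" by (simp add: f0)
    also have "(\<Sum>n<N. ?f (Suc n) X) = F X - 1 + ?f N X"
      using sum.lessThan_Suc_shift[of "\<lambda>n. ?f n X" N] by (simp add: F_def f_0)
    finally show ?thesis .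
  qed
  obtain h where h: "0 < h" and cmp: "\<And>k z X Y. 0 \<le> k \<Longrightarrow> k \<le> h \<Longrightarrow> cmod (z - of_real E) \<le> h \<Longrightarrow> cmod (X - Y) \<le> h
      \<Longrightarrow> transfer_op k z F X \<le> radial_op E (\<lambda>X. ennreal (F X)) Y + ennreal (1/4)"
    by (rule transfer_op_compare[OF F0 FM uc, of "1/4" E]) (use that in auto)
  \<comment> \<open>The perturbation costs 1/4 of the decrease 1/2. The remaining 1/4 is at least
    \<open>F X / (4 * M)\<close>, which makes the decrease multiplicative.\<close>
  define l where "l = 1 - 1 / (4 * M)"
  have l: "0 < l" "l < 1" using M1 by (auto simp: l_def field_simps)
  have "transfer_op k z F X \<le> ennreal (l * F X)" if "0 \<le> k" "k \<le> h" "cmod (z - of_real E) \<le> h" for k z X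
  proof -
    have "transfer_op k z F X \<le> ennreal (F X - 1 + ?f N X) + ennreal (1/4)"
      using cmp[OF that, of X X] h unfolding radial_F by simp
    also have "\<dots> = ennreal (F X - 1 + ?f N X + 1/4)"
      using F1[of X] f0[of N X] by (intro ennreal_plus[symmetric]) auto
    also have "\<dots> \<le> ennreal (l * F X)"
    proof (rule ennreal_leI)
      have "F X / (4 * M) \<le> 1/4" using FM[of X] M1 by (simp add: divide_le_eq)
      then have "F X - 1/4 \<le> l * F X" by (simp add: l_def algebra_simps)
      then show "F X - 1 + ?f N X + 1/4 \<le> l * F X" using fN[of X] by linarith
    qed
    finally show ?thesis .
  qed
  then show ?thesis using that[OF F1 FM meas h l] by blast
qed

end

section \<open>Expectation over the random potential\<close>

text \<open>\<open>effective_energy q p \<kappa> z j k\<close> is \<open>z\<close> plus the sum of the two forward Green functions at level \<open>k\<close>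
  of the tree cut off after \<open>j\<close> levels \<open>k, \<dots>, k + j - 1\<close>; \<open>sphere_product\<close> with parameters \<open>r\<close>, \<open>j\<close>, \<open>k\<close>
  collects the \<open>\<ell>\<^sup>2\<close> norms of these pairs over \<open>r\<close> levels.\<close>

fun effective_energy :: "(nat \<Rightarrow> real) \<Rightarrow> (nat \<Rightarrow> real \<times> real) \<Rightarrow> real \<Rightarrow> complex \<Rightarrow> nat \<Rightarrow> nat \<Rightarrow> complex" where
  "effective_energy q p \<kappa> z 0 k = z"
| "effective_energy q p \<kappa> z (Suc j) k =
    z + 1 / (of_real (q k + \<kappa> * fst (p k)) - effective_energy q p \<kappa> z j (Suc k))
      + 1 / (of_real (q k + \<kappa> * snd (p k)) - effective_energy q p \<kappa> z j (Suc k))"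

fun sphere_product :: "(nat \<Rightarrow> real) \<Rightarrow> (nat \<Rightarrow> real \<times> real) \<Rightarrow> real \<Rightarrow> complex \<Rightarrow> nat \<Rightarrow> nat \<Rightarrow> nat \<Rightarrow> real" where
  "sphere_product q p \<kappa> z 0 j k = 1"
| "sphere_product q p \<kappa> z (Suc r) j k =
    norm (1 / (of_real (q k + \<kappa> * fst (p k)) - effective_energy q p \<kappa> z (j - 1) (Suc k)),
          1 / (of_real (q k + \<kappa> * snd (p k)) - effective_energy q p \<kappa> z (j - 1) (Suc k)))
    * sphere_product q p \<kappa> z r (j - 1) (Suc k)"

lemma sphere_product_nonneg: "0 \<le> sphere_product q p \<kappa> z r j k"
  by (induction r arbitrary: j k) auto

lemma effective_energy_upd: "i < k \<Longrightarrow> effective_energy (q(i := a)) (p(i := b)) \<kappa> z j k = effective_energy q p \<kappa> z j k"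
  by (induction j arbitrary: k) auto

lemma sphere_product_upd: "i < k \<Longrightarrow> sphere_product (q(i := a)) (p(i := b)) \<kappa> z r j k = sphere_product q p \<kappa> z r j k"
  by (induction r arbitrary: j k) (auto simp: effective_energy_upd)

lemma measurable_fst_borel: "fst \<in> borel_measurable (borel :: (real \<times> real) measure)"
  and measurable_snd_borel: "snd \<in> borel_measurable (borel :: (real \<times> real) measure)"
  by (auto intro!: borel_measurable_continuous_onI continuous_intros)

lemma measurable_effective_energy [measurable]:
  assumes [measurable]: "\<And>i. (\<lambda>w. q w i) \<in> borel_measurable M" "\<And>i. (\<lambda>w. p w i) \<in> borel_measurable M"
  shows "(\<lambda>w. effective_energy (q w) (p w) \<kappa> z j k) \<in> borel_measurable M"
proof (induction j arbitrary: k)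
  case (Suc j)
  note [measurable] = Suc.IH measurable_compose[OF assms(2) measurable_fst_borel]
    measurable_compose[OF assms(2) measurable_snd_borel]
  show ?case unfolding effective_energy.simps by measurable
qed simp

lemma measurable_sphere_product [measurable]:
  assumes [measurable]: "\<And>i. (\<lambda>w. q w i) \<in> borel_measurable M" "\<And>i. (\<lambda>w. p w i) \<in> borel_measurable M"
  shows "(\<lambda>w. sphere_product (q w) (p w) \<kappa> z r j k) \<in> borel_measurable M"
proof (induction r arbitrary: j k)
  case (Suc r)
  note [measurable] = Suc.IH measurable_compose[OF assms(2) measurable_fst_borel]
    measurable_compose[OF assms(2) measurable_snd_borel]
  show ?case unfolding sphere_product.simps norm_Pair by measurable
qed simp

text \<open>Overwriting one coordinate by an independent copy leaves the product measure unchanged.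
  A level can thus be integrated out without splitting the infinite product.\<close>

lemma nn_integral_PiM_resample:
  assumes M: "\<And>i. prob_space (M i)" and [measurable]: "f \<in> borel_measurable (PiM UNIV M)"
  shows "(\<integral>\<^sup>+x. f x \<partial>PiM UNIV M) = (\<integral>\<^sup>+x. \<integral>\<^sup>+a. f (x(k := a)) \<partial>M k \<partial>PiM UNIV M)"
proof -
  interpret P: prob_space "PiM UNIV M" by (intro prob_space_PiM M)
  interpret K: prob_space "M k" by (rule M)
  interpret PK: pair_sigma_finite "M k" "PiM UNIV M" ..
  have upd [measurable]: "(\<lambda>(a, x). x(k := a)) \<in> M k \<Otimes>\<^sub>M PiM UNIV M \<rightarrow>\<^sub>M PiM UNIV M"
    unfolding case_prod_unfold by (rule measurable_fun_upd[where J = UNIV]) auto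
  have "PiM UNIV M = distr (M k \<Otimes>\<^sub>M PiM UNIV M) (PiM UNIV M) (\<lambda>(a, x). x(k := a))"
    using distr_pair_PiM_eq_PiM[of UNIV M k] M by simp
  then have "(\<integral>\<^sup>+x. f x \<partial>PiM UNIV M) = (\<integral>\<^sup>+x. f x \<partial>distr (M k \<Otimes>\<^sub>M PiM UNIV M) (PiM UNIV M) (\<lambda>(a, x). x(k := a)))"
    by simp
  also have "\<dots> = (\<integral>\<^sup>+y. f ((\<lambda>(a, x). x(k := a)) y) \<partial>(M k \<Otimes>\<^sub>M PiM UNIV M))"
    by (rule nn_integral_distr) measurable
  also have "\<dots> = (\<integral>\<^sup>+x. \<integral>\<^sup>+a. f (x(k := a)) \<partial>M k \<partial>PiM UNIV M)"
    by (subst PK.nn_integral_snd[symmetric]) (auto simp: case_prod_unfold)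
  finally show ?thesis .
qed

locale anderson_root = anderson_tree g B sig + root: bounded_density g0 B
  for g B sig g0
begin

definition pot :: "((nat \<Rightarrow> real) \<times> (nat \<Rightarrow> real \<times> real)) measure" where
  "pot = pot_space root.nu nu sig"

abbreviation "Mq \<equiv> \<lambda>n::nat. if n = 0 then root.nu else nu"

lemma prob_Mq: "prob_space (Mq n)" 
  using nu.prob_space_axioms root.nu.prob_space_axioms by simp

lemma pot_eq: "pot = PiM UNIV Mq \<Otimes>\<^sub>M PiM UNIV (\<lambda>_. sig)"
  by (simp add: pot_def pot_space_def)

sublocale PQ: prob_space "PiM UNIV Mq"
  by (intro prob_space_PiM prob_Mq)

sublocale PP: prob_space "PiM (UNIV :: nat set) (\<lambda>_. sig)"
  by (intro prob_space_PiM prob_space_sig)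

sublocale PQP: pair_prob_space "PiM UNIV Mq" "PiM (UNIV :: nat set) (\<lambda>_. sig)" ..

lemma prob_space_pot: "prob_space pot"
  unfolding pot_eq by (rule PQP.prob_space_axioms)

lemma measurable_fst_pot [measurable]: "(\<lambda>w. fst w i) \<in> borel_measurable pot"
proof -
  have "(\<lambda>w. fst w i) \<in> measurable pot (Mq i)"
    unfolding pot_eq by (rule measurable_compose[OF measurable_fst]) (rule measurable_component_singleton, simp)
  moreover have "sets (Mq i) = sets borel" by simp
  ultimately show ?thesis using measurable_cong_sets[OF refl, of "Mq i" borel pot] by blast
qed

lemma measurable_snd_pot [measurable]: "(\<lambda>w. snd w i) \<in> borel_measurable pot"
proof -
  have "(\<lambda>w. snd w i) \<in> measurable pot sig"
    unfolding pot_eq by (rule measurable_compose[OF measurable_snd]) (rule measurable_component_singleton, simp)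
  then show ?thesis using measurable_cong_sets[OF refl sets_sig, of pot] by blast
qed

lemma measurable_resample:
  assumes "f \<in> borel_measurable (PiM UNIV Mq \<Otimes>\<^sub>M PiM UNIV (\<lambda>_::nat. sig))"
    and "u \<in> N \<rightarrow>\<^sub>M PiM UNIV Mq" "a \<in> N \<rightarrow>\<^sub>M Mq k"
    and "v \<in> N \<rightarrow>\<^sub>M PiM UNIV (\<lambda>_::nat. sig)" "b \<in> N \<rightarrow>\<^sub>M sig"
  shows "(\<lambda>y. f ((u y)(k := a y), (v y)(k := b y))) \<in> borel_measurable N"
  by (rule measurable_compose[OF measurable_Pair assms(1)]; rule measurable_fun_upd[where J = UNIV])
     (use assms in auto)

lemma nn_integral_pot_resample:
  assumes "f \<in> borel_measurable pot"
  shows "(\<integral>\<^sup>+w. f w \<partial>pot)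
    = (\<integral>\<^sup>+w. \<integral>\<^sup>+b. \<integral>\<^sup>+a. f ((fst w)(k := a), (snd w)(k := b)) \<partial>Mq k \<partial>sig \<partial>pot)"
proof -
  let ?Q = "PiM UNIV Mq" and ?P = "PiM UNIV (\<lambda>_::nat. sig)"
  interpret K: prob_space "Mq k" by (rule prob_Mq)
  interpret S: pair_sigma_finite sig ?Q ..
  have f [measurable]: "f \<in> borel_measurable (?Q \<Otimes>\<^sub>M ?P)" using assms unfolding pot_eq .
  have m2: "(\<lambda>x. \<integral>\<^sup>+q. f (q, x) \<partial>?Q) \<in> borel_measurable ?P" by measurable
  have "(\<integral>\<^sup>+w. f w \<partial>pot) = (\<integral>\<^sup>+p. \<integral>\<^sup>+q. f (q, p) \<partial>?Q \<partial>?P)"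
    unfolding pot_eq by (rule PQP.nn_integral_snd[symmetric]) (simp add: case_prod_unfold)
  also have "\<dots> = (\<integral>\<^sup>+p. \<integral>\<^sup>+b. \<integral>\<^sup>+q. f (q, p(k := b)) \<partial>?Q \<partial>sig \<partial>?P)"
    by (rule nn_integral_PiM_resample[OF prob_space_sig m2])
  also have "\<dots> = (\<integral>\<^sup>+p. \<integral>\<^sup>+b. \<integral>\<^sup>+q. \<integral>\<^sup>+a. f (q(k := a), p(k := b)) \<partial>Mq k \<partial>?Q \<partial>sig \<partial>?P)"
  proof (rule nn_integral_cong, rule nn_integral_cong)
    fix p b assume "p \<in> space ?P" "b \<in> space sig"
    then have "p(k := b) \<in> space ?P" by (simp add: space_PiM)
    then have "(\<lambda>q. f (q, p(k := b))) \<in> borel_measurable ?Q" by measurable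
    from nn_integral_PiM_resample[OF prob_Mq this, of k]
    show "(\<integral>\<^sup>+q. f (q, p(k := b)) \<partial>?Q) = (\<integral>\<^sup>+q. \<integral>\<^sup>+a. f (q(k := a), p(k := b)) \<partial>Mq k \<partial>?Q)" .
  qed
  \<comment> \<open>The two redrawn variables become innermost, in the order in which
    \<open>transfer_op\<close> integrates them.\<close>
  also have "\<dots> = (\<integral>\<^sup>+p. \<integral>\<^sup>+q. \<integral>\<^sup>+b. \<integral>\<^sup>+a. f (q(k := a), p(k := b)) \<partial>Mq k \<partial>sig \<partial>?Q \<partial>?P)"
  proof (rule nn_integral_cong)
    fix p assume p: "p \<in> space ?P"
    have "(\<lambda>y. f ((snd (fst y))(k := snd y), p(k := fst (fst y)))) \<in> borel_measurable ((sig \<Otimes>\<^sub>M ?Q) \<Otimes>\<^sub>M Mq k)"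
      by (rule measurable_resample[OF f]) (use p in auto)
    then have "case_prod (\<lambda>b q. \<integral>\<^sup>+a. f (q(k := a), p(k := b)) \<partial>Mq k) \<in> borel_measurable (sig \<Otimes>\<^sub>M ?Q)"
      unfolding case_prod_unfold by (intro K.borel_measurable_nn_integral) (simp add: case_prod_unfold)
    from S.Fubini'[OF this]
    show "(\<integral>\<^sup>+b. \<integral>\<^sup>+q. \<integral>\<^sup>+a. f (q(k := a), p(k := b)) \<partial>Mq k \<partial>?Q \<partial>sig)
        = (\<integral>\<^sup>+q. \<integral>\<^sup>+b. \<integral>\<^sup>+a. f (q(k := a), p(k := b)) \<partial>Mq k \<partial>sig \<partial>?Q)" by (rule sym)
  qed
  also have "\<dots> = (\<integral>\<^sup>+w. \<integral>\<^sup>+b. \<integral>\<^sup>+a. f ((fst w)(k := a), (snd w)(k := b)) \<partial>Mq k \<partial>sig \<partial>pot)"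
    unfolding pot_eq
  proof (subst PQP.nn_integral_snd[symmetric])
    have "(\<lambda>y. f ((fst (fst (fst y)))(k := snd y), (snd (fst (fst y)))(k := snd (fst y))))
      \<in> borel_measurable (((?Q \<Otimes>\<^sub>M ?P) \<Otimes>\<^sub>M sig) \<Otimes>\<^sub>M Mq k)"
      by (rule measurable_resample[OF f]) auto
    then have "(\<lambda>y. \<integral>\<^sup>+a. f ((fst (fst y))(k := a), (snd (fst y))(k := snd y)) \<partial>Mq k)
      \<in> borel_measurable ((?Q \<Otimes>\<^sub>M ?P) \<Otimes>\<^sub>M sig)"
      by (intro K.borel_measurable_nn_integral) (simp add: case_prod_unfold)
    then show "(\<lambda>w. \<integral>\<^sup>+b. \<integral>\<^sup>+a. f ((fst w)(k := a), (snd w)(k := b)) \<partial>Mq k \<partial>sig)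
      \<in> borel_measurable (?Q \<Otimes>\<^sub>M ?P)"
      by (intro sig.borel_measurable_nn_integral) (simp add: case_prod_unfold)
  qed simp
  finally show ?thesis .
qed

text \<open>Resampling the potential at level \<open>k\<close>, on which nothing further out depends, turns one factor of
  the product into an application of the transfer operator.\<close>

lemma sphere_product_expectation_bound:
  assumes F: "\<And>X. 1 \<le> F X" "\<And>X. F X \<le> M" "F \<in> borel_measurable borel" and l: "0 < l"
    and step: "\<And>X. transfer_op \<kappa> z F X \<le> ennreal (l * F X)"
    and k: "0 < k" and r: "r \<le> j"
  shows "(\<integral>\<^sup>+w. ennreal (F (effective_energy (fst w) (snd w) \<kappa> z j k) * sqrt (sphere_product (fst w) (snd w) \<kappa> z r j k)) \<partial>pot)
    \<le> ennreal (l ^ r * M)"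
  using k r
proof (induction r arbitrary: j k)
  case 0
  have "(\<integral>\<^sup>+w. ennreal (F (effective_energy (fst w) (snd w) \<kappa> z j k)) \<partial>pot) \<le> (\<integral>\<^sup>+w. ennreal M \<partial>pot)"
    by (intro nn_integral_mono ennreal_leI F)
  also have "\<dots> = ennreal M" using prob_space.emeasure_space_1[OF prob_space_pot] by simp
  finally show ?case by simp
next
  case (Suc r)
  note [measurable] = F(3)
  have F0: "0 \<le> F X" for X using F(1)[of X] by linarith
  obtain i where j: "j = Suc i" "r \<le> i" using Suc.prems by (cases j) auto
  let ?X = "\<lambda>w. effective_energy (fst w) (snd w) \<kappa> z i (Suc k)" and ?R = "\<lambda>w. sqrt (sphere_product (fst w) (snd w) \<kappa> z r i (Suc k))"
  let ?I = "\<lambda>w. ennreal (F (effective_energy (fst w) (snd w) \<kappa> z j k) * sqrt (sphere_product (fst w) (snd w) \<kappa> z (Suc r) j k))"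
  have I: "?I w = ennreal (step_weight F z (of_real (fst w k + \<kappa> * fst (snd w k)) - ?X w) (of_real (fst w k + \<kappa> * snd (snd w k)) - ?X w)) * ennreal (?R w)" for w
  proof -
    have "F (effective_energy (fst w) (snd w) \<kappa> z j k) * sqrt (sphere_product (fst w) (snd w) \<kappa> z (Suc r) j k)
      = step_weight F z (of_real (fst w k + \<kappa> * fst (snd w k)) - ?X w) (of_real (fst w k + \<kappa> * snd (snd w k)) - ?X w) * ?R w"
      unfolding j step_weight_def by (simp add: real_sqrt_mult)
    then show ?thesis using step_weight_nonneg[OF F0] sphere_product_nonneg by (simp add: ennreal_mult)
  qed
  \<comment> \<open>The root potential has its own law, so the induction stays on positive
    levels.\<close>
  have Mk: "Mq k = nu" using Suc.prems by simp
  have mI: "?I \<in> borel_measurable pot" by measurable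
  have "(\<integral>\<^sup>+w. ?I w \<partial>pot) = (\<integral>\<^sup>+w. transfer_op \<kappa> z F (?X w) * ennreal (?R w) \<partial>pot)"
    unfolding nn_integral_pot_resample[OF mI, of k] Mk
  proof (rule nn_integral_cong)
    fix w
    have "(\<integral>\<^sup>+b. \<integral>\<^sup>+a. ?I ((fst w)(k := a), (snd w)(k := b)) \<partial>nu \<partial>sig)
      = (\<integral>\<^sup>+b. \<integral>\<^sup>+a. ennreal (step_weight F z (of_real (a + \<kappa> * fst b) - ?X w) (of_real (a + \<kappa> * snd b) - ?X w)) * ennreal (?R w) \<partial>nu \<partial>sig)"
    proof (rule nn_integral_cong, rule nn_integral_cong)
      fix a b
      show "?I ((fst w)(k := a), (snd w)(k := b))
        = ennreal (step_weight F z (of_real (a + \<kappa> * fst b) - ?X w) (of_real (a + \<kappa> * snd b) - ?X w)) * ennreal (?R w)"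
        using I[of "((fst w)(k := a), (snd w)(k := b))"]
        by (simp only: fst_conv snd_conv fun_upd_same effective_energy_upd[OF lessI] sphere_product_upd[OF lessI])
    qed
    also have "\<dots> = (\<integral>\<^sup>+b. (\<integral>\<^sup>+a. ennreal (step_weight F z (of_real (a + \<kappa> * fst b) - ?X w) (of_real (a + \<kappa> * snd b) - ?X w)) \<partial>nu) * ennreal (?R w) \<partial>sig)"
      by (rule nn_integral_cong, rule nn_integral_multc) measurable
    also have "\<dots> = transfer_op \<kappa> z F (?X w) * ennreal (?R w)"
      unfolding transfer_op_def
    proof (rule nn_integral_multc)
      have [measurable]: "(\<lambda>x. fst (fst x)) \<in> borel_measurable (sig \<Otimes>\<^sub>M nu)" "(\<lambda>x. snd (fst x)) \<in> borel_measurable (sig \<Otimes>\<^sub>M nu)"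
        by (auto intro!: measurable_compose[OF measurable_fst] simp: measurable_fst_borel measurable_snd_borel
            cong: measurable_cong_sets)
      show "(\<lambda>b. \<integral>\<^sup>+a. ennreal (step_weight F z (of_real (a + \<kappa> * fst b) - ?X w) (of_real (a + \<kappa> * snd b) - ?X w)) \<partial>nu)
        \<in> borel_measurable sig"
        by (intro nu.borel_measurable_nn_integral) (unfold case_prod_unfold, measurable)
    qed
    finally show "(\<integral>\<^sup>+b. \<integral>\<^sup>+a. ?I ((fst w)(k := a), (snd w)(k := b)) \<partial>nu \<partial>sig) = transfer_op \<kappa> z F (?X w) * ennreal (?R w)" .
  qed
  also have "\<dots> \<le> (\<integral>\<^sup>+w. ennreal l * ennreal (F (?X w) * ?R w) \<partial>pot)"
  proof (rule nn_integral_mono)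
    fix w
    have "transfer_op \<kappa> z F (?X w) * ennreal (?R w) \<le> ennreal (l * F (?X w)) * ennreal (?R w)"
      by (intro mult_right_mono step) auto
    also have "\<dots> = ennreal l * ennreal (F (?X w) * ?R w)"
      using l F0 sphere_product_nonneg by (simp add: ennreal_mult mult.assoc)
    finally show "transfer_op \<kappa> z F (?X w) * ennreal (?R w) \<le> ennreal l * ennreal (F (?X w) * ?R w)" .
  qed
  also have "\<dots> = ennreal l * (\<integral>\<^sup>+w. ennreal (F (?X w) * ?R w) \<partial>pot)"
    by (rule nn_integral_cmult) measurable
  also have "\<dots> \<le> ennreal l * ennreal (l ^ r * M)"
    by (intro mult_left_mono Suc.IH) (use j in auto)
  also have "\<dots> = ennreal (l ^ Suc r * M)"
    using l order_trans[OF F(1) F(2)] by (subst ennreal_mult[symmetric]) (auto simp: mult.assoc)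
  finally show ?case .
qed

text \<open>All decay comes from the levels below the root; the root factor only needs a bounded 1/2
  moment, and \<open>1 + 4 * B\<close> is that of \<open>root.moment\<close>. As \<open>F\<close> is
  at least 1, it may be inserted to start the bound at level 1.\<close>

lemma truncated_green_bound:
  assumes F: "\<And>X. 1 \<le> F X" "\<And>X. F X \<le> M" "F \<in> borel_measurable borel" and l: "0 < l"
    and step: "\<And>X. transfer_op \<kappa> z F X \<le> ennreal (l * F X)" and n: "n \<le> N"
  shows "(\<integral>\<^sup>+w. ennreal (sqrt (cmod (1 / (of_real (fst w 0) - effective_energy (fst w) (snd w) \<kappa> z N (Suc 0))))
        * sqrt (sphere_product (fst w) (snd w) \<kappa> z n N (Suc 0))) \<partial>pot) \<le> ennreal ((1 + 4 * B) * (l ^ n * M))"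
proof -
  note [measurable] = F(3)
  let ?X = "\<lambda>w. effective_energy (fst w) (snd w) \<kappa> z N (Suc 0)" and ?R = "\<lambda>w. sqrt (sphere_product (fst w) (snd w) \<kappa> z n N (Suc 0))"
  let ?I = "\<lambda>w. ennreal (sqrt (cmod (1 / (of_real (fst w 0) - ?X w))) * ?R w)"
  have F0: "0 \<le> F X" for X using F(1)[of X] by linarith
  have M0: "0 \<le> M" using F0 F(2) order_trans by blast
  have mI: "?I \<in> borel_measurable pot" by measurable
  have "(\<integral>\<^sup>+w. ?I w \<partial>pot) = (\<integral>\<^sup>+w. (\<integral>\<^sup>+a. ennreal (sqrt (cmod (1 / (of_real a - ?X w)))) \<partial>root.nu) * ennreal (?R w) \<partial>pot)"
    unfolding nn_integral_pot_resample[OF mI, of 0]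
  proof (rule nn_integral_cong)
    fix w
    have "(\<integral>\<^sup>+b. \<integral>\<^sup>+a. ?I ((fst w)(0 := a), (snd w)(0 := b)) \<partial>Mq 0 \<partial>sig)
      = (\<integral>\<^sup>+b. \<integral>\<^sup>+a. ennreal (sqrt (cmod (1 / (of_real a - ?X w)))) * ennreal (?R w) \<partial>root.nu \<partial>sig)"
      by (simp only: fst_conv snd_conv fun_upd_same effective_energy_upd[OF lessI] sphere_product_upd[OF lessI] if_True refl
          ennreal_mult real_sqrt_ge_zero norm_ge_zero sphere_product_nonneg)
    also have "\<dots> = (\<integral>\<^sup>+a. ennreal (sqrt (cmod (1 / (of_real a - ?X w)))) \<partial>root.nu) * ennreal (?R w)"
      by (simp add: nn_integral_multc sig.emeasure_space_1[simplified])
    finally show "(\<integral>\<^sup>+b. \<integral>\<^sup>+a. ?I ((fst w)(0 := a), (snd w)(0 := b)) \<partial>Mq 0 \<partial>sig)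
      = (\<integral>\<^sup>+a. ennreal (sqrt (cmod (1 / (of_real a - ?X w)))) \<partial>root.nu) * ennreal (?R w)" .
  qed
  also have "\<dots> \<le> (\<integral>\<^sup>+w. ennreal (1 + 4 * B) * ennreal (F (?X w) * ?R w) \<partial>pot)"
  proof (rule nn_integral_mono)
    fix w
    have "(\<integral>\<^sup>+a. ennreal (sqrt (cmod (1 / (of_real a - ?X w)))) \<partial>root.nu)
      \<le> (\<integral>\<^sup>+a. ennreal (\<bar>a - Re (?X w)\<bar> powr - (1/2)) \<partial>root.nu)"
    proof (rule nn_integral_mono_AE)
      show "AE a in root.nu. ennreal (sqrt (cmod (1 / (of_real a - ?X w)))) \<le> ennreal (\<bar>a - Re (?X w)\<bar> powr - (1/2))"
        using root.AE_nu_neq[of "Re (?X w)"]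
      proof eventually_elim
        case (elim a)
        have "\<bar>a - Re (?X w)\<bar> \<le> cmod (of_real a - ?X w)"
          using abs_Re_le_cmod[of "of_real a - ?X w"] by simp
        then have "sqrt (cmod (1 / (of_real a - ?X w))) \<le> sqrt (1 / \<bar>a - Re (?X w)\<bar>)"
          using elim by (simp add: norm_divide frac_le)
        also have "\<dots> = \<bar>a - Re (?X w)\<bar> powr - (1/2)"
          by (simp add: powr_minus_divide powr_half_sqrt real_sqrt_divide)
        finally show ?case by (rule ennreal_leI)
      qed
    qed
    also have "\<dots> \<le> ennreal (1 + 2 * B / (1 - 1/2))" by (rule root.moment) auto
    finally have "(\<integral>\<^sup>+a. ennreal (sqrt (cmod (1 / (of_real a - ?X w)))) \<partial>root.nu) \<le> ennreal (1 + 4 * B)" by simp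
    moreover have "ennreal (?R w) \<le> ennreal (F (?X w) * ?R w)"
      using mult_right_mono[OF F(1)[of "?X w"], of "?R w"] sphere_product_nonneg by (intro ennreal_leI) simp
    ultimately show "(\<integral>\<^sup>+a. ennreal (sqrt (cmod (1 / (of_real a - ?X w)))) \<partial>root.nu) * ennreal (?R w)
      \<le> ennreal (1 + 4 * B) * ennreal (F (?X w) * ?R w)"
      by (intro mult_mono) auto
  qed
  also have "\<dots> = ennreal (1 + 4 * B) * (\<integral>\<^sup>+w. ennreal (F (?X w) * ?R w) \<partial>pot)"
    by (rule nn_integral_cmult) measurable
  also have "\<dots> \<le> ennreal (1 + 4 * B) * ennreal (l ^ n * M)"
    by (intro mult_left_mono sphere_product_expectation_bound[OF F l step _ n]) auto
  also have "\<dots> = ennreal ((1 + 4 * B) * (l ^ n * M))"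
    using B_nonneg l M0 by (intro ennreal_mult[symmetric]) auto
  finally show ?thesis .
qed

end

section \<open>Truncated Green functions\<close>

lemma finite_sphere [simp]: "finite (sphere n)"
  unfolding sphere_def using finite_lists_length_eq[of "UNIV :: bool set" n] by simp

lemma sphere_0: "sphere 0 = {[]}"
  by (auto simp: sphere_def)

lemma sum_sphere_Suc:
  "(\<Sum>x\<in>sphere (Suc n). g x) = (\<Sum>x\<in>sphere n. g (x @ [False]) + g (x @ [True]))"
  for g :: "vertex \<Rightarrow> 'a::comm_monoid_add"
proof -
  have eq: "sphere (Suc n) = (\<lambda>x. x @ [False]) ` sphere n \<union> (\<lambda>x. x @ [True]) ` sphere n"
  proof (intro set_eqI iffI)
    fix y assume "y \<in> sphere (Suc n)"
    then obtain x c where y: "y = x @ [c]" "length x = n"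
      by (auto simp: sphere_def length_Suc_conv_rev)
    then show "y \<in> (\<lambda>x. x @ [False]) ` sphere n \<union> (\<lambda>x. x @ [True]) ` sphere n"
      by (cases c) (auto simp: sphere_def)
  qed (auto simp: sphere_def)
  show ?thesis
    unfolding eq
    by (subst sum.union_disjoint) (auto simp: sum.reindex inj_on_def sum.distrib)
qed

section \<open>Current through spheres and energy balance\<close>

definition flux :: "(vertex \<Rightarrow> complex) \<Rightarrow> nat \<Rightarrow> real" where
  "flux D n = (\<Sum>x\<in>sphere n. Im (cnj (D x) * (D (x @ [False]) + D (x @ [True]))))"

text \<open>Pair the equation with \<open>cnj D\<close> and take imaginary parts. The potential is
  real and every edge inside the ball is met from both ends with conjugate terms, so only
  \<open>Im z\<close> and the current out of the ball remain. This identity stands in for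
  self-adjointness in the existence, uniqueness and convergence arguments.\<close>

lemma flux_balance:
  assumes eq: "\<And>x. length x \<le> N \<Longrightarrow> Hop q p \<kappa> D x - z * D x = f x"
  shows "Im z * (\<Sum>n\<le>N. \<Sum>x\<in>sphere n. (cmod (D x))\<^sup>2)
    = - flux D N - (\<Sum>n\<le>N. \<Sum>x\<in>sphere n. Im (cnj (D x) * f x))"
  using eq
proof (induction N)
  case 0
  have "Im (cnj (D []) * f []) = Im (cnj (D []) * (Hop q p \<kappa> D [] - z * D []))" using 0 by simp
  also have "\<dots> = - Im z * (cmod (D []))\<^sup>2 - Im (cnj (D []) * (D [False] + D [True]))"
    unfolding Hop_def adj_def cmod_power2 by (simp add: algebra_simps power2_eq_square)
  finally show ?case by (simp add: sphere_0 flux_def algebra_simps)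
next
  case (Suc N)
  have pt: "Im (cnj (D x) * f x) = - Im z * (cmod (D x))\<^sup>2
      - Im (cnj (D x) * (D (x @ [False]) + D (x @ [True]))) - Im (cnj (D x) * D (butlast x))"
    if "x \<in> sphere (Suc N)" for x
  proof -
    have "x \<noteq> []" "length x \<le> Suc N" using that by (auto simp: sphere_def)
    then have "Im (cnj (D x) * f x) = Im (cnj (D x) * (Hop q p \<kappa> D x - z * D x))" using Suc.prems by simp
    also have "\<dots> = - Im z * (cmod (D x))\<^sup>2
      - Im (cnj (D x) * (D (x @ [False]) + D (x @ [True]))) - Im (cnj (D x) * D (butlast x))"
      using \<open>x \<noteq> []\<close> unfolding Hop_def adj_def cmod_power2 by (simp add: algebra_simps power2_eq_square)
    finally show ?thesis .
  qed
  have "(\<Sum>x\<in>sphere (Suc N). Im (cnj (D x) * f x)) = (\<Sum>x\<in>sphere (Suc N). - Im z * (cmod (D x))\<^sup>2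
      - Im (cnj (D x) * (D (x @ [False]) + D (x @ [True]))) - Im (cnj (D x) * D (butlast x)))"
    by (rule sum.cong[OF refl pt])
  also have "\<dots> = - Im z * (\<Sum>x\<in>sphere (Suc N). (cmod (D x))\<^sup>2) - flux D (Suc N)
      - (\<Sum>x\<in>sphere (Suc N). Im (cnj (D x) * D (butlast x)))"
    by (simp only: sum_subtractf flux_def sum_distrib_left)
  also have "(\<Sum>x\<in>sphere (Suc N). Im (cnj (D x) * D (butlast x))) = - flux D N"
    unfolding sum_sphere_Suc flux_def sum_negf[symmetric]
    by (intro sum.cong) (auto simp: algebra_simps)
  finally have "(\<Sum>x\<in>sphere (Suc N). Im (cnj (D x) * f x)) =
    - Im z * (\<Sum>x\<in>sphere (Suc N). (cmod (D x))\<^sup>2) - flux D (Suc N) + flux D N" by simp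
  moreover have "Im z * (\<Sum>n\<le>N. \<Sum>x\<in>sphere n. (cmod (D x))\<^sup>2)
    = - flux D N - (\<Sum>n\<le>N. \<Sum>x\<in>sphere n. Im (cnj (D x) * f x))"
    using Suc by simp
  ultimately show ?case by (simp add: distrib_left)
qed

section \<open>Gaussian elimination on the truncated tree\<close>

locale truncation =
  fixes q :: "nat \<Rightarrow> real" and p :: "nat \<Rightarrow> real \<times> real" and \<kappa> :: real and z :: complex
  assumes Im_z: "0 < Im z"
begin

definition V :: "vertex \<Rightarrow> real" where
  "V x = Qr q x + \<kappa> * Qt p x"

text \<open>Herglotz property: if \<open>w\<close> has positive imaginary part, so has
  \<open>1 / (r - w)\<close> for real \<open>r\<close>. Hence no denominator vanishes.\<close>

lemma Im_effective_energy: "Im z \<le> Im (effective_energy q p \<kappa> z j k)"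
proof (induction j arbitrary: k)
  case (Suc j)
  have "0 \<le> Im (1 / (of_real r - effective_energy q p \<kappa> z j (Suc k)))" for r
    using Suc[of "Suc k"] Im_z by (simp add: Im_divide)
  then show ?case by (simp add: add_increasing2 add_nonneg_nonneg del: of_real_add of_real_mult)
qed simp

text \<open>The value 0 beyond level \<open>N\<close> is a Dirichlet cutoff: a vertex at level
  \<open>N\<close> then satisfies the same identities as an interior one, with effective energy
  \<open>z\<close>.\<close>

definition forward_green :: "nat \<Rightarrow> vertex \<Rightarrow> complex" where
  "forward_green N x = (if length x \<le> N then 1 / (of_real (V x) - effective_energy q p \<kappa> z (N - length x) (Suc (length x))) else 0)"

lemma denominator_nonzero: "of_real r - effective_energy q p \<kappa> z j k \<noteq> 0"
proof
  assume "of_real r - effective_energy q p \<kappa> z j k = 0"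
  then have "Im (of_real r - effective_energy q p \<kappa> z j k) = 0" by simp
  then show False using Im_effective_energy[of j k] Im_z by simp
qed

lemma V_snoc: "V (x @ [False]) = q (Suc (length x)) + \<kappa> * fst (p (Suc (length x)))"
  "V (x @ [True]) = q (Suc (length x)) + \<kappa> * snd (p (Suc (length x)))"
  by (simp_all add: V_def Qr_def Qt_def)

lemma effective_energy_forward_green:
  assumes "length x \<le> N"
  shows "effective_energy q p \<kappa> z (N - length x) (Suc (length x)) = z + forward_green N (x @ [False]) + forward_green N (x @ [True])"
proof (cases "length x = N")
  case False
  then have "N - length x = Suc (N - Suc (length x))" using assms by simp
  then show ?thesis using False assms by (simp add: forward_green_def V_snoc)
qed (simp add: forward_green_def)

text \<open>Gaussian elimination from the leaves: the equation at \<open>x\<close> reads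
  \<open>sol x = forward_green x * (sol (parent x) + source x)\<close>.\<close>

fun folded_source :: "nat \<Rightarrow> (vertex \<Rightarrow> complex) \<Rightarrow> nat \<Rightarrow> vertex \<Rightarrow> complex" where
  "folded_source N f 0 x = f x"
| "folded_source N f (Suc r) x = f x + forward_green N (x @ [False]) * folded_source N f r (x @ [False]) + forward_green N (x @ [True]) * folded_source N f r (x @ [True])"

definition source :: "nat \<Rightarrow> nat \<Rightarrow> (vertex \<Rightarrow> complex) \<Rightarrow> vertex \<Rightarrow> complex" where
  "source N n f x = (if length x \<le> n then folded_source N f (n - length x) x else 0)"

text \<open>Back substitution runs from the root outwards and thus strips the last letter of a path;
  on the reversed list this is structural recursion.\<close>

fun rev_sol :: "nat \<Rightarrow> nat \<Rightarrow> (vertex \<Rightarrow> complex) \<Rightarrow> vertex \<Rightarrow> complex" where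
  "rev_sol N n f [] = forward_green N [] * source N n f []"
| "rev_sol N n f (c # y) = forward_green N (rev (c # y)) * (rev_sol N n f y + source N n f (rev (c # y)))"

definition sol :: "nat \<Rightarrow> nat \<Rightarrow> (vertex \<Rightarrow> complex) \<Rightarrow> vertex \<Rightarrow> complex" where
  "sol N n f x = rev_sol N n f (rev x)"

lemma sol_Nil: "sol N n f [] = forward_green N [] * source N n f []"
  and sol_snoc: "sol N n f (x @ [c]) = forward_green N (x @ [c]) * (sol N n f x + source N n f (x @ [c]))"
  by (simp_all add: sol_def)

lemma sol_outside: "N < length x \<Longrightarrow> sol N n f x = 0"
  by (cases x rule: rev_cases) (auto simp: sol_snoc forward_green_def)

lemma source_rec:
  assumes "\<forall>x. x \<notin> sphere n \<longrightarrow> f x = 0"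
  shows "source N n f x = f x + forward_green N (x @ [False]) * source N n f (x @ [False])
    + forward_green N (x @ [True]) * source N n f (x @ [True])"
proof -
  consider "length x < n" | "length x = n" | "n < length x" by linarith
  then show ?thesis
  proof cases
    case 1
    then have "n - length x = Suc (n - Suc (length x))" by simp
    then show ?thesis using 1 by (simp add: source_def)
  next
    case 3
    then show ?thesis using assms by (simp add: source_def sphere_def)
  qed (simp add: source_def)
qed

lemma sol_equation:
  assumes f: "\<forall>x. x \<notin> sphere n \<longrightarrow> f x = 0" and x: "length x \<le> N"
  shows "Hop q p \<kappa> (sol N n f) x - z * sol N n f x = f x"
proof -
  let ?v = "of_real (V x) - effective_energy q p \<kappa> z (N - length x) (Suc (length x))"
  let ?par = "if x = [] then 0 else sol N n f (butlast x)"
  have "sol N n f x = forward_green N x * (?par + source N n f x)"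
    by (cases x rule: rev_cases) (auto simp: sol_Nil sol_snoc)
  then have 1: "?v * sol N n f x = ?par + source N n f x"
    using x denominator_nonzero[of "V x"] by (simp add: forward_green_def)
  have "Hop q p \<kappa> (sol N n f) x - z * sol N n f x
    = (of_real (V x) - z) * sol N n f x - sol N n f (x @ [False]) - sol N n f (x @ [True]) - ?par"
    by (simp add: Hop_def adj_def V_def algebra_simps)
  also have "\<dots> = ?v * sol N n f x - (forward_green N (x @ [False]) * source N n f (x @ [False])
    + forward_green N (x @ [True]) * source N n f (x @ [True])) - ?par"
    unfolding sol_snoc effective_energy_forward_green[OF x] by (simp only: algebra_simps)
  also have "\<dots> = f x"
    unfolding 1 using source_rec[OF f, where N = N and x = x] by simp
  finally show ?thesis .
qed

text \<open>Cauchy-Schwarz over the two children costs the squared norm of the pair of forward Green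
  functions. The pair depends on the level and not on the vertex, so the factor leaves the sum over
  the sphere, and the level norms simply multiply.\<close>

lemma source_bound:
  assumes f: "\<forall>x. x \<notin> sphere n \<longrightarrow> f x = 0" and "r \<le> n" "n \<le> N"
  shows "(\<Sum>x\<in>sphere (n - r). (cmod (folded_source N f r x))\<^sup>2)
    \<le> (sphere_product q p \<kappa> z r (N - n + r) (Suc (n - r)))\<^sup>2 * (\<Sum>x\<in>sphere n. (cmod (f x))\<^sup>2)"
  using assms(2)
proof (induction r)
  case (Suc r)
  define k where "k = n - r"
  have k: "k = Suc (n - Suc r)" "N - k = N - n + r" "k \<le> N" using Suc.prems assms(3) by (auto simp: k_def)
  let ?m0 = "1 / (of_real (q k + \<kappa> * fst (p k)) - effective_energy q p \<kappa> z (N - k) (Suc k))"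
  let ?m1 = "1 / (of_real (q k + \<kappa> * snd (p k)) - effective_energy q p \<kappa> z (N - k) (Suc k))"
  have m: "forward_green N (x @ [False]) = ?m0" "forward_green N (x @ [True]) = ?m1" if "x \<in> sphere (n - Suc r)" for x
    using that k by (auto simp: forward_green_def V_snoc sphere_def)
  have "(\<Sum>x\<in>sphere (n - Suc r). (cmod (folded_source N f (Suc r) x))\<^sup>2)
    \<le> (\<Sum>x\<in>sphere (n - Suc r). (norm (?m0, ?m1))\<^sup>2 * ((cmod (folded_source N f r (x @ [False])))\<^sup>2 + (cmod (folded_source N f r (x @ [True])))\<^sup>2))"
  proof (rule sum_mono)
    fix x assume x: "x \<in> sphere (n - Suc r)"
    let ?a = "folded_source N f r (x @ [False])" and ?b = "folded_source N f r (x @ [True])"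
    have "f x = 0" using f x Suc.prems by (auto simp: sphere_def)
    then have "folded_source N f (Suc r) x = ?m0 * ?a + ?m1 * ?b" using m[OF x] by simp
    then have "cmod (folded_source N f (Suc r) x) \<le> cmod ?m0 * cmod ?a + cmod ?m1 * cmod ?b"
      by (metis norm_mult norm_triangle_ineq)
    then have "(cmod (folded_source N f (Suc r) x))\<^sup>2 \<le> (cmod ?m0 * cmod ?a + cmod ?m1 * cmod ?b)\<^sup>2"
      by (intro power_mono) auto
    also have "\<dots> \<le> ((cmod ?m0)\<^sup>2 + (cmod ?m1)\<^sup>2) * ((cmod ?a)\<^sup>2 + (cmod ?b)\<^sup>2)"
    proof -
      have "0 \<le> (s * d - t * c)\<^sup>2" for s t c d :: real by simp
      from this[of "cmod ?m0" "cmod ?b" "cmod ?m1" "cmod ?a"] show ?thesis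
        by (simp only: power2_eq_square algebra_simps)
    qed
    also have "(cmod ?m0)\<^sup>2 + (cmod ?m1)\<^sup>2 = (norm (?m0, ?m1))\<^sup>2" by (simp add: norm_Pair)
    finally show "(cmod (folded_source N f (Suc r) x))\<^sup>2
      \<le> (norm (?m0, ?m1))\<^sup>2 * ((cmod ?a)\<^sup>2 + (cmod ?b)\<^sup>2)" .
  qed
  also have "\<dots> = (norm (?m0, ?m1))\<^sup>2 * (\<Sum>x\<in>sphere (n - r). (cmod (folded_source N f r x))\<^sup>2)"
    unfolding k_def[symmetric] k(1) sum_sphere_Suc by (simp add: sum_distrib_left k_def)
  also have "\<dots> \<le> (norm (?m0, ?m1))\<^sup>2 * ((sphere_product q p \<kappa> z r (N - n + r) (Suc (n - r)))\<^sup>2 * (\<Sum>x\<in>sphere n. (cmod (f x))\<^sup>2))"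
    using Suc by (intro mult_left_mono) auto
  also have "\<dots> = (sphere_product q p \<kappa> z (Suc r) (N - n + Suc r) (Suc (n - Suc r)))\<^sup>2 * (\<Sum>x\<in>sphere n. (cmod (f x))\<^sup>2)"
    unfolding k(1)[symmetric] k(2) by (simp add: power_mult_distrib k_def)
  finally show ?case .
qed simp

lemma sol_root_bound:
  assumes f: "\<forall>x. x \<notin> sphere n \<longrightarrow> f x = 0" and n: "n \<le> N"
    and f1: "(\<Sum>x\<in>sphere n. (cmod (f x))\<^sup>2) \<le> 1"
  shows "cmod (sol N n f []) \<le> cmod (1 / (of_real (q 0) - effective_energy q p \<kappa> z N (Suc 0))) * sphere_product q p \<kappa> z n N (Suc 0)"
proof -
  have "(cmod (folded_source N f n []))\<^sup>2 \<le> (sphere_product q p \<kappa> z n N (Suc 0))\<^sup>2 * (\<Sum>x\<in>sphere n. (cmod (f x))\<^sup>2)"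
    using source_bound[OF f order_refl n] n by (simp add: sphere_0)
  also have "\<dots> \<le> (sphere_product q p \<kappa> z n N (Suc 0))\<^sup>2 * 1"
    using f1 by (intro mult_left_mono) auto
  finally have "(cmod (folded_source N f n []))\<^sup>2 \<le> (sphere_product q p \<kappa> z n N (Suc 0))\<^sup>2" by (simp only: mult_1_right)
  then have "cmod (folded_source N f n []) \<le> sphere_product q p \<kappa> z n N (Suc 0)"
    by (rule power2_le_imp_le) (rule sphere_product_nonneg)
  moreover have "sol N n f [] = 1 / (of_real (q 0) - effective_energy q p \<kappa> z N (Suc 0)) * folded_source N f n []"
    by (simp add: sol_Nil source_def forward_green_def V_def Qr_def Qt_def)
  ultimately show ?thesis by (simp only: norm_mult mult_left_mono norm_ge_zero)
qed

text \<open>The usual resolvent bound by \<open>1 / Im z\<close>, uniform in the depth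
  \<open>N\<close>: the outgoing current is zero because the truncated solution vanishes on level
  \<open>N + 1\<close>.\<close>

lemma sol_energy:
  assumes f: "\<forall>x. x \<notin> sphere n \<longrightarrow> f x = 0" and n: "n \<le> N"
  shows "(\<Sum>k\<le>N. \<Sum>x\<in>sphere k. (cmod (sol N n f x))\<^sup>2) \<le> (\<Sum>x\<in>sphere n. (cmod (f x))\<^sup>2) / (Im z)\<^sup>2"
proof -
  let ?e = "Im z" and ?s = "sol N n f"
  let ?m = "\<lambda>k. \<Sum>x\<in>sphere k. (cmod (?s x))\<^sup>2"
  have fl: "flux ?s N = 0"
    unfolding flux_def by (intro sum.neutral) (auto simp: sphere_def sol_outside)
  have eq: "Hop q p \<kappa> ?s x - z * ?s x = f x" if "length x \<le> N" for x
    by (rule sol_equation[OF f that])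
  have "?e * (\<Sum>k\<le>N. ?m k) = - (\<Sum>k\<le>N. \<Sum>x\<in>sphere k. Im (cnj (?s x) * f x))"
    using flux_balance[where N = N, OF eq] unfolding fl by simp
  also have "(\<Sum>k\<le>N. \<Sum>x\<in>sphere k. Im (cnj (?s x) * f x)) = (\<Sum>k\<in>{n}. \<Sum>x\<in>sphere k. Im (cnj (?s x) * f x))"
    using n f by (intro sum.mono_neutral_right) (auto simp: sphere_def intro!: sum.neutral)
  also have "\<dots> = (\<Sum>x\<in>sphere n. Im (cnj (?s x) * f x))" by simp
  also have "- \<dots> = (\<Sum>x\<in>sphere n. - Im (cnj (?s x) * f x))" by (rule sum_negf[symmetric])
  also have "\<dots> \<le> (\<Sum>x\<in>sphere n. ?e / 2 * (cmod (?s x))\<^sup>2 + 1 / (2 * ?e) * (cmod (f x))\<^sup>2)"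
  proof (rule sum_mono)
    fix x
    have "- Im (cnj (?s x) * f x) \<le> cmod (cnj (?s x) * f x)"
      using abs_Im_le_cmod[of "cnj (?s x) * f x"] by linarith
    also have "\<dots> = cmod (?s x) * cmod (f x)" by (simp add: norm_mult)
    also have "\<dots> \<le> ?e / 2 * (cmod (?s x))\<^sup>2 + 1 / (2 * ?e) * (cmod (f x))\<^sup>2"
    proof -
      have "0 \<le> (?e * cmod (?s x) - cmod (f x))\<^sup>2 / (2 * ?e)" using Im_z by simp
      also have "\<dots> = ?e / 2 * (cmod (?s x))\<^sup>2 + 1 / (2 * ?e) * (cmod (f x))\<^sup>2 - cmod (?s x) * cmod (f x)"
        using Im_z by (simp add: field_simps power2_eq_square)
      finally show ?thesis by simp
    qed
    finally show "- Im (cnj (?s x) * f x) \<le> ?e / 2 * (cmod (?s x))\<^sup>2 + 1 / (2 * ?e) * (cmod (f x))\<^sup>2" .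
  qed
  also have "\<dots> = ?e / 2 * ?m n + 1 / (2 * ?e) * (\<Sum>x\<in>sphere n. (cmod (f x))\<^sup>2)"
    by (simp add: sum.distrib sum_distrib_left)
  also have "?m n \<le> (\<Sum>k\<le>N. ?m k)"
    using n by (intro member_le_sum) (auto intro: sum_nonneg)
  finally have "?e * (\<Sum>k\<le>N. ?m k) \<le> ?e / 2 * (\<Sum>k\<le>N. ?m k) + 1 / (2 * ?e) * (\<Sum>x\<in>sphere n. (cmod (f x))\<^sup>2)"
    using Im_z by (simp add: mult_left_mono)
  then show ?thesis using Im_z by (simp add: field_simps power2_eq_square)
qed

end

section \<open>The resolvent as a limit of truncations\<close>

lemma l2_sum_le:
  assumes "l2 f" "finite F"
  shows "(\<Sum>x\<in>F. (cmod (f x))\<^sup>2) \<le> (l2norm f)\<^sup>2"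
proof -
  have "(\<Sum>x\<in>F. (cmod (f x))\<^sup>2) \<le> (\<Sum>\<^sub>\<infinity>x. (cmod (f x))\<^sup>2)"
    by (rule finite_sum_le_infsum) (use assms in \<open>auto simp: l2_def\<close>)
  also have "\<dots> = (l2norm f)\<^sup>2"
    unfolding l2norm_def by (subst real_sqrt_pow2) (auto intro: infsum_nonneg)
  finally show ?thesis .
qed

lemma disjoint_sphere: "i \<noteq> j \<Longrightarrow> sphere i \<inter> sphere j = {}"
  by (auto simp: sphere_def)

lemma l2_sphere_tendsto:
  assumes "l2 f"
  shows "(\<lambda>n. \<Sum>x\<in>sphere n. (cmod (f x))\<^sup>2) \<longlonglongrightarrow> 0"
proof (rule summable_LIMSEQ_zero, rule summableI_nonneg_bounded)
  fix n
  have "(\<Sum>i<n. \<Sum>x\<in>sphere i. (cmod (f x))\<^sup>2) = (\<Sum>x\<in>(\<Union>i<n. sphere i). (cmod (f x))\<^sup>2)"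
    by (intro sum.UNION_disjoint[symmetric]) (simp_all add: disjoint_sphere)
  also have "\<dots> \<le> (l2norm f)\<^sup>2"
    by (rule l2_sum_le[OF assms]) simp
  finally show "(\<Sum>i<n. \<Sum>x\<in>sphere i. (cmod (f x))\<^sup>2) \<le> (l2norm f)\<^sup>2" .
qed (auto intro: sum_nonneg)

context truncation
begin

text \<open>Inside the ball the difference solves the homogeneous equation, and on level
  \<open>N + 1\<close> it equals \<open>\<psi>\<close>, so the outgoing current is controlled by the
  mass of \<open>\<psi>\<close> there, which tends to 0. As the approximants do not depend on
  \<open>\<psi>\<close>, this also yields uniqueness.\<close>

lemma sol_tendsto:
  assumes f: "\<forall>x. x \<notin> sphere n \<longrightarrow> f x = 0" and l2: "l2 \<psi>"
    and eq: "\<And>x. Hop q p \<kappa> \<psi> x - z * \<psi> x = f x"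
  shows "(\<lambda>N. sol N n f x) \<longlonglongrightarrow> \<psi> x"
proof -
  let ?t = "\<lambda>k. \<Sum>x\<in>sphere k. (cmod (\<psi> x))\<^sup>2" and ?e = "Im z"
  have bound: "(cmod (\<psi> x - sol N n f x))\<^sup>2 \<le> 2 / ?e\<^sup>2 * ?t (Suc N)" if x: "length x \<le> N" for x N
  proof -
    define D where "D y = \<psi> y - sol N n f y" for y
    let ?m = "\<lambda>k. \<Sum>x\<in>sphere k. (cmod (D x))\<^sup>2"
    have "Hop q p \<kappa> D y - z * D y = 0" if "length y \<le> N" for y
    proof -
      have "Hop q p \<kappa> D y - z * D y = (Hop q p \<kappa> \<psi> y - z * \<psi> y) - (Hop q p \<kappa> (sol N n f) y - z * sol N n f y)"
        by (simp add: Hop_def adj_def D_def algebra_simps)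
      also have "\<dots> = 0" unfolding eq sol_equation[OF f that] by simp
      finally show ?thesis .
    qed
    from flux_balance[where N = N, OF this] have "?e * (\<Sum>k\<le>N. ?m k) = - flux D N" by simp
    also have "\<dots> = (\<Sum>x\<in>sphere N. - Im (cnj (D x) * (D (x @ [False]) + D (x @ [True]))))"
      unfolding flux_def by (rule sum_negf[symmetric])
    also have "\<dots> \<le> (\<Sum>x\<in>sphere N. ?e / 2 * (cmod (D x))\<^sup>2 + 1 / ?e * ((cmod (\<psi> (x @ [False])))\<^sup>2 + (cmod (\<psi> (x @ [True])))\<^sup>2))"
    proof (rule sum_mono)
      fix x assume x: "x \<in> sphere N"
      let ?a = "cmod (\<psi> (x @ [False]))" and ?b = "cmod (\<psi> (x @ [True]))" and ?d = "cmod (D x)"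
      have D: "D (x @ [c]) = \<psi> (x @ [c])" for c
        using x by (simp add: D_def sol_outside sphere_def)
      have "- Im (cnj (D x) * (D (x @ [False]) + D (x @ [True]))) \<le> cmod (cnj (D x) * (D (x @ [False]) + D (x @ [True])))"
        using abs_Im_le_cmod[of "cnj (D x) * (D (x @ [False]) + D (x @ [True]))"] by linarith
      also have "\<dots> \<le> ?d * (?a + ?b)"
        unfolding D norm_mult complex_mod_cnj by (intro mult_left_mono norm_triangle_ineq) auto
      also have "\<dots> \<le> ?e / 2 * ?d\<^sup>2 + 1 / ?e * (?a\<^sup>2 + ?b\<^sup>2)"
      proof -
        have "0 \<le> ((?e * ?d - (?a + ?b))\<^sup>2 + (?a - ?b)\<^sup>2) / (2 * ?e)" using Im_z by simp
        also have "\<dots> = ?e / 2 * ?d\<^sup>2 + 1 / ?e * (?a\<^sup>2 + ?b\<^sup>2) - ?d * (?a + ?b)"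
          using Im_z by (simp add: field_simps power2_eq_square)
        finally show ?thesis by simp
      qed
      finally show "- Im (cnj (D x) * (D (x @ [False]) + D (x @ [True]))) \<le> ?e / 2 * ?d\<^sup>2 + 1 / ?e * (?a\<^sup>2 + ?b\<^sup>2)" .
    qed
    also have "\<dots> = ?e / 2 * ?m N + 1 / ?e * ?t (Suc N)"
      by (simp only: sum.distrib sum_distrib_left[symmetric] sum_sphere_Suc)
    also have "?m N \<le> (\<Sum>k\<le>N. ?m k)"
      by (intro member_le_sum) (auto intro: sum_nonneg)
    finally have "?e * (\<Sum>k\<le>N. ?m k) \<le> ?e / 2 * (\<Sum>k\<le>N. ?m k) + 1 / ?e * ?t (Suc N)"
      using Im_z by (simp add: mult_left_mono)
    then have le: "(\<Sum>k\<le>N. ?m k) \<le> 2 / ?e\<^sup>2 * ?t (Suc N)"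
      using Im_z by (simp add: field_simps power2_eq_square)
    have "(cmod (D x))\<^sup>2 \<le> ?m (length x)"
      by (rule member_le_sum[of x "sphere (length x)" "\<lambda>x. (cmod (D x))\<^sup>2"], simp add: sphere_def) auto
    also have "\<dots> \<le> (\<Sum>k\<le>N. ?m k)"
      by (rule member_le_sum[of "length x" "{..N}" ?m]) (use x in \<open>auto intro: sum_nonneg\<close>)
    finally show ?thesis using le by (simp add: D_def)
  qed
  have "(\<lambda>N. sqrt (2 / ?e\<^sup>2 * ?t (Suc N))) \<longlonglongrightarrow> sqrt (2 / ?e\<^sup>2 * 0)"
    by (intro tendsto_intros LIMSEQ_Suc l2_sphere_tendsto l2)
  then have lim: "(\<lambda>N. sqrt (2 / ?e\<^sup>2 * ?t (Suc N))) \<longlonglongrightarrow> 0" by simp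
  have "(\<lambda>N. \<psi> x - sol N n f x) \<longlonglongrightarrow> 0"
    by (rule Lim_null_comparison[OF _ lim])
       (intro eventually_sequentiallyI[of "length x"] real_le_rsqrt bound)
  then have "(\<lambda>N. \<psi> x - (\<psi> x - sol N n f x)) \<longlonglongrightarrow> \<psi> x - 0"
    by (intro tendsto_diff tendsto_const)
  then show ?thesis by simp
qed

lemma sol_bounded:
  assumes f: "\<forall>x. x \<notin> sphere n \<longrightarrow> f x = 0" and n: "n \<le> N" and F: "finite F"
  shows "(\<Sum>x\<in>F. (cmod (sol N n f x))\<^sup>2) \<le> (\<Sum>x\<in>sphere n. (cmod (f x))\<^sup>2) / (Im z)\<^sup>2"
proof -
  let ?g = "\<lambda>x. (cmod (sol N n f x))\<^sup>2"
  have "length x \<le> N" if "sol N n f x \<noteq> 0" for x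
    using sol_outside[of N x n f] that by (cases "length x \<le> N") auto
  then have "(\<Sum>x\<in>F. ?g x) = (\<Sum>x\<in>F \<inter> (\<Union>k\<le>N. sphere k). ?g x)"
    by (intro sum.mono_neutral_right) (use F in \<open>auto simp: sphere_def\<close>)
  also have "\<dots> \<le> (\<Sum>x\<in>(\<Union>k\<le>N. sphere k). ?g x)"
    by (intro sum_mono2) auto
  also have "\<dots> = (\<Sum>k\<le>N. \<Sum>x\<in>sphere k. ?g x)"
    by (intro sum.UNION_disjoint) (simp_all add: disjoint_sphere)
  also have "\<dots> \<le> (\<Sum>x\<in>sphere n. (cmod (f x))\<^sup>2) / (Im z)\<^sup>2"
    by (rule sol_energy[OF f n])
  finally show ?thesis .
qed

text \<open>The energy bound is uniform in the depth, so a diagonal subsequence converges at every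
  vertex. The bound survives on finite sets of vertices, and the equation, involving finitely many
  vertices, survives the pointwise limit.\<close>

lemma solution_exists:
  assumes f: "\<forall>x. x \<notin> sphere n \<longrightarrow> f x = 0"
  obtains \<psi> where "l2 \<psi>" "\<And>x. Hop q p \<kappa> \<psi> x - z * \<psi> x = f x"
proof -
  define C where "C = (\<Sum>x\<in>sphere n. (cmod (f x))\<^sup>2) / (Im z)\<^sup>2"
  have bound: "norm (sol (n + i) n f x) \<le> sqrt C" for i x
    using sol_bounded[OF f, of "n + i" "{x}"] by (intro real_le_rsqrt) (simp add: C_def)
  obtain k where k: "strict_mono k" and conv: "\<And>x. \<exists>l. (\<lambda>i. sol (n + k i) n f x) \<longlonglongrightarrow> l"
  proof (rule function_convergent_subsequence[of UNIV "\<lambda>i. sol (n + i) n f" "sqrt C"])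
    show "norm (sol (n + i) n f x) \<le> sqrt C" if "x \<in> UNIV" for i x by (rule bound)
  qed (simp, rule that, simp_all)
  have "\<forall>x. \<exists>l. (\<lambda>i. sol (n + k i) n f x) \<longlonglongrightarrow> l" using conv by blast
  from choice[OF this] obtain \<psi> where \<psi>: "\<And>x. (\<lambda>i. sol (n + k i) n f x) \<longlonglongrightarrow> \<psi> x"
    by blast
  have "l2 \<psi>"
    unfolding l2_def
  proof (rule nonneg_bounded_partial_sums_imp_summable_on[where C = C])
    show "eventually (\<lambda>F. (\<Sum>x\<in>F. (cmod (\<psi> x))\<^sup>2) \<le> C) (finite_subsets_at_top UNIV)"
    proof (rule eventually_finite_subsets_at_top_weakI)
      fix F :: "vertex set" assume F: "finite F"
      have "(\<lambda>i. \<Sum>x\<in>F. (cmod (sol (n + k i) n f x))\<^sup>2) \<longlonglongrightarrow> (\<Sum>x\<in>F. (cmod (\<psi> x))\<^sup>2)"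
        by (intro tendsto_intros \<psi>)
      then show "(\<Sum>x\<in>F. (cmod (\<psi> x))\<^sup>2) \<le> C"
        by (rule LIMSEQ_le_const2) (use sol_bounded[OF f _ F] in \<open>auto simp: C_def\<close>)
    qed
  qed auto
  moreover have "Hop q p \<kappa> \<psi> x - z * \<psi> x = f x" for x
  proof -
    let ?L = "\<lambda>\<phi>. Hop q p \<kappa> \<phi> x - z * \<phi> x"
    have "(\<lambda>i. ?L (sol (n + k i) n f)) \<longlonglongrightarrow> ?L \<psi>"
      unfolding Hop_def adj_def by (cases "x = []") (auto intro!: tendsto_intros \<psi>)
    moreover have "eventually (\<lambda>i. ?L (sol (n + k i) n f) = f x) sequentially"
      unfolding eventually_sequentially
    proof (intro exI allI impI)
      fix i assume "length x \<le> i"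
      then have "length x \<le> n + k i" using seq_suble[OF k, of i] by linarith
      then show "?L (sol (n + k i) n f) = f x" by (rule sol_equation[OF f])
    qed
    then have "(\<lambda>i. ?L (sol (n + k i) n f)) \<longlonglongrightarrow> f x" by (rule tendsto_eventually)
    ultimately show ?thesis by (rule LIMSEQ_unique)
  qed
  ultimately show ?thesis using that by blast
qed

lemma sol_tendsto_resolvent:
  assumes f: "\<forall>x. x \<notin> sphere n \<longrightarrow> f x = 0"
  shows "(\<lambda>N. sol N n f x) \<longlonglongrightarrow> resolvent q p \<kappa> z f x"
proof -
  obtain \<psi> where \<psi>: "l2 \<psi>" "\<And>x. Hop q p \<kappa> \<psi> x - z * \<psi> x = f x"
    by (rule solution_exists[OF f]) (rule that)
  have "resolvent q p \<kappa> z f = \<psi>"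
    unfolding resolvent_def
  proof (rule the_equality)
    fix \<phi> assume \<phi>: "l2 \<phi> \<and> (\<forall>x. Hop q p \<kappa> \<phi> x - z * \<phi> x = f x)"
    show "\<phi> = \<psi>"
    proof
      fix x
      show "\<phi> x = \<psi> x"
        using \<phi> by (intro LIMSEQ_unique[OF sol_tendsto[OF f, of \<phi> x] sol_tendsto[OF f \<psi>]]) auto
    qed
  qed (use \<psi> in auto)
  then show ?thesis using sol_tendsto[OF f \<psi>] by simp
qed

lemma l2norm_proj_root: "l2norm (proj (sphere 0) \<psi>) = cmod (\<psi> [])"
proof -
  have "(\<Sum>\<^sub>\<infinity>x. (cmod (proj (sphere 0) \<psi> x))\<^sup>2) = (\<Sum>\<^sub>\<infinity>x\<in>{[]}. (cmod (\<psi> x))\<^sup>2)"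
    by (rule infsum_cong_neutral) (auto simp: proj_def sphere_0)
  then show ?thesis by (simp add: l2norm_def)
qed

text \<open>The bound on the truncated solution at the root is the same for all sources in the unit
  ball, so it passes to the supremum. The form with \<open>liminf\<close> is the one that Fatou's
  lemma takes.\<close>

lemma green_norm_le_liminf:
  "ennreal (green_norm q p \<kappa> z n powr (1/2))
    \<le> liminf (\<lambda>N. ennreal (sqrt (cmod (1 / (of_real (q 0) - effective_energy q p \<kappa> z (n + N) (Suc 0)))) * sqrt (sphere_product q p \<kappa> z n (n + N) (Suc 0))))"
    (is "_ \<le> liminf ?g")
proof (cases "liminf ?g")
  case (real c)
  let ?A = "{l2norm (proj (sphere 0) (resolvent q p \<kappa> z (proj (sphere n) f))) | f. l2 f \<and> l2norm f \<le> 1}"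
  have A: "0 \<le> a \<and> a \<le> c\<^sup>2" if "a \<in> ?A" for a
  proof -
    obtain f where f: "l2 f" "l2norm f \<le> 1" and a: "a = cmod (resolvent q p \<kappa> z (proj (sphere n) f) [])"
      using \<open>a \<in> ?A\<close> unfolding l2norm_proj_root by blast
    let ?f = "proj (sphere n) f"
    have f0: "\<forall>x. x \<notin> sphere n \<longrightarrow> ?f x = 0" by (simp add: proj_def)
    have "(\<Sum>x\<in>sphere n. (cmod (?f x))\<^sup>2) = (\<Sum>x\<in>sphere n. (cmod (f x))\<^sup>2)"
      by (simp add: proj_def)
    also have "\<dots> \<le> (l2norm f)\<^sup>2" by (rule l2_sum_le) (use f in auto)
    also have "\<dots> \<le> 1" using f by (intro power_le_one) (auto simp: l2norm_def intro: infsum_nonneg)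
    finally have f1: "(\<Sum>x\<in>sphere n. (cmod (?f x))\<^sup>2) \<le> 1" .
    have "(\<lambda>N. ennreal (sqrt (cmod (sol (N + n) n ?f [])))) \<longlonglongrightarrow> ennreal (sqrt a)"
      unfolding a by (intro tendsto_intros LIMSEQ_ignore_initial_segment sol_tendsto_resolvent f0)
    then have "ennreal (sqrt a) = liminf (\<lambda>N. ennreal (sqrt (cmod (sol (N + n) n ?f []))))"
      by (intro lim_imp_Liminf[symmetric]) auto
    also have "\<dots> \<le> liminf ?g"
    proof (rule Liminf_mono, rule always_eventually, rule allI)
      fix N
      have "cmod (sol (n + N) n ?f []) \<le> cmod (1 / (of_real (q 0) - effective_energy q p \<kappa> z (n + N) (Suc 0))) * sphere_product q p \<kappa> z n (n + N) (Suc 0)"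
        by (rule sol_root_bound[OF f0 _ f1]) auto
      then have "sqrt (cmod (sol (n + N) n ?f [])) \<le> sqrt (cmod (1 / (of_real (q 0) - effective_energy q p \<kappa> z (n + N) (Suc 0)))) * sqrt (sphere_product q p \<kappa> z n (n + N) (Suc 0))"
        unfolding real_sqrt_mult[symmetric] by (rule real_sqrt_le_mono)
      then show "ennreal (sqrt (cmod (sol (N + n) n ?f []))) \<le> ?g N"
        unfolding add.commute[of N n] by (rule ennreal_leI)
    qed
    also have "\<dots> = ennreal c" by (rule real(2))
    finally have "sqrt a \<le> c" using real(1) by simp
    moreover have "0 \<le> a" by (simp add: a)
    ultimately show ?thesis using real_sqrt_le_iff[of a "c\<^sup>2"] real(1) by simp
  qed
  \<comment> \<open>A real supremum carries information only for a nonempty set bounded above; the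
    zero source gives a member and \<open>A\<close> the bound.\<close>
  have ne: "?A \<noteq> {}"
  proof -
    have "l2 (\<lambda>_. 0)" "l2norm (\<lambda>_. 0) \<le> 1" by (simp_all add: l2_def l2norm_def)
    then show ?thesis by blast
  qed
  have "Sup ?A \<le> c\<^sup>2" by (rule cSup_least[OF ne]) (use A in blast)
  moreover have "0 \<le> Sup ?A"
  proof -
    obtain a where a: "a \<in> ?A" using ne by blast
    have "a \<le> Sup ?A" by (rule cSup_upper[OF a]) (use A in \<open>auto intro!: bdd_aboveI[of _ "c\<^sup>2"]\<close>)
    then show ?thesis using A[OF a] by linarith
  qed
  ultimately have "Sup ?A powr (1/2) \<le> c"
    using real(1) by (simp add: powr_half_sqrt real_le_lsqrt)
  then show ?thesis unfolding real(2) green_norm_def by (rule ennreal_leI)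
qed simp

end

theorem theorem1p2:
  fixes nu0 nu :: "real measure" and sig :: "(real \<times> real) measure"
    and g0 g :: "real \<Rightarrow> real" and K B :: real
  assumes "nu0 = density lborel (\<lambda>x. ennreal (g0 x))"
    and "nu = density lborel (\<lambda>x. ennreal (g x))"
    and "g0 \<in> borel_measurable borel" and "g \<in> borel_measurable borel"
    and "\<And>x. 0 \<le> g0 x \<and> g0 x \<le> B" and "\<And>x. 0 \<le> g x \<and> g x \<le> B"
    and "\<And>x. \<bar>x\<bar> > K \<Longrightarrow> g0 x = 0" and "\<And>x. \<bar>x\<bar> > K \<Longrightarrow> g x = 0"
    and "prob_space nu0" and "prob_space nu"
    and "prob_space sig" and "sets sig = sets borel"
    and "emeasure sig ({-1..1} \<times> {-1..1}) = 1"
  shows "\<forall>E0::real. \<exists>a b. a < E0 \<and> E0 < b \<and>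
     (\<exists>s \<epsilon>0 \<kappa>0 C L :: real. 0 < s \<and> s < 1 \<and> 0 < \<epsilon>0 \<and> 0 < \<kappa>0 \<and> 1 < L \<and>
        (\<forall>\<kappa>\<in>{0..\<kappa>0}. \<forall>n::nat. \<forall>E\<in>{a<..<b}. \<forall>\<epsilon>\<in>{0<..<\<epsilon>0}.
           (\<integral>\<^sup>+ \<omega>. ennreal ((green_norm (fst \<omega>) (snd \<omega>) \<kappa> (Complex E \<epsilon>) n) powr s)
               \<partial>(pot_space nu0 nu sig))
           \<le> ennreal (C * L powr (- real n))))"
proof
  fix E0 :: real
  have g: "bounded_density g B"
    using assms(4,6,10) unfolding assms(2) by (intro bounded_density.intro) blast+
  have g0: "bounded_density g0 B"
    using assms(3,5,9) unfolding assms(1) by (intro bounded_density.intro) blast+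
  interpret A: anderson_root g B sig g0
    by (intro anderson_root.intro anderson_tree.intro anderson_tree_axioms.intro g g0 assms)
  have pot: "pot_space nu0 nu sig = A.pot"
    unfolding A.pot_def A.nu_def A.root.nu_def assms(1,2) ..
  obtain F M h l where F: "\<And>X. 1 \<le> F X" "\<And>X. F X \<le> M" "F \<in> borel_measurable borel"
    and h: "0 < h" and l: "0 < l" "l < 1"
    and step: "\<And>k z X. 0 \<le> k \<Longrightarrow> k \<le> h \<Longrightarrow> cmod (z - of_real E0) \<le> h \<Longrightarrow> A.transfer_op k z F X \<le> ennreal (l * F X)"
    by (rule A.lyapunov[of E0]) (rule that)
  \<comment> \<open>Half of \<open>h\<close> goes to the real part of the energy and half to the
    imaginary part, so \<open>z\<close> stays within \<open>h\<close> of \<open>E0\<close>.\<close>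
  have bound: "(\<integral>\<^sup>+ \<omega>. ennreal ((green_norm (fst \<omega>) (snd \<omega>) \<kappa> (Complex E \<epsilon>) n) powr (1/2)) \<partial>(pot_space nu0 nu sig))
      \<le> ennreal ((1 + 4 * B) * M * (1 / l) powr (- real n))"
    if \<kappa>: "\<kappa> \<in> {0..h}" and E: "E \<in> {E0 - h / 2<..<E0 + h / 2}" and \<epsilon>: "\<epsilon> \<in> {0<..<h / 2}" for \<kappa> n E \<epsilon>
  proof -
    let ?z = "Complex E \<epsilon>"
    let ?g = "\<lambda>N \<omega>. ennreal (sqrt (cmod (1 / (of_real (fst \<omega> 0) - effective_energy (fst \<omega>) (snd \<omega>) \<kappa> ?z (n + N) (Suc 0))))
      * sqrt (sphere_product (fst \<omega>) (snd \<omega>) \<kappa> ?z n (n + N) (Suc 0)))"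
    have "cmod (?z - of_real E0) \<le> \<bar>E - E0\<bar> + \<bar>\<epsilon>\<bar>"
      using cmod_le[of "?z - of_real E0"] by simp
    also have "\<dots> \<le> h" using E \<epsilon> by (auto simp: abs_if)
    finally have z: "cmod (?z - of_real E0) \<le> h" .
    have "(\<integral>\<^sup>+ \<omega>. ennreal ((green_norm (fst \<omega>) (snd \<omega>) \<kappa> ?z n) powr (1/2)) \<partial>A.pot)
      \<le> (\<integral>\<^sup>+ \<omega>. liminf (\<lambda>N. ?g N \<omega>) \<partial>A.pot)"
    proof (rule nn_integral_mono)
      fix \<omega> :: "(nat \<Rightarrow> real) \<times> (nat \<Rightarrow> real \<times> real)"
      interpret truncation "fst \<omega>" "snd \<omega>" \<kappa> ?z by unfold_locales (use \<epsilon> in simp)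
      show "ennreal ((green_norm (fst \<omega>) (snd \<omega>) \<kappa> ?z n) powr (1/2)) \<le> liminf (\<lambda>N. ?g N \<omega>)"
        by (rule green_norm_le_liminf)
    qed
    \<comment> \<open>Fatou's lemma is applied to the truncated expressions, which are measurable
      functions of finitely many potentials and whose means are bounded independently of the depth;
      the resolvent itself enters only through the pointwise inequality above.\<close>
    also have "\<dots> \<le> liminf (\<lambda>N. \<integral>\<^sup>+ \<omega>. ?g N \<omega> \<partial>A.pot)"
      by (rule nn_integral_liminf) measurable
    also have "\<dots> \<le> liminf (\<lambda>N::nat. ennreal ((1 + 4 * B) * (l ^ n * M)))"
      by (intro Liminf_mono always_eventually allI A.truncated_green_bound[OF F l(1)] step z)
         (use \<kappa> in auto)
    also have "\<dots> = ennreal ((1 + 4 * B) * (l ^ n * M))"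
      by (simp add: Liminf_const)
    also have "l ^ n = (1 / l) powr (- real n)"
      using l by (simp add: powr_minus powr_realpow power_one_over inverse_eq_divide)
    finally show ?thesis unfolding pot by (simp add: mult_ac)
  qed
  show "\<exists>a b. a < E0 \<and> E0 < b \<and>
     (\<exists>s \<epsilon>0 \<kappa>0 C L :: real. 0 < s \<and> s < 1 \<and> 0 < \<epsilon>0 \<and> 0 < \<kappa>0 \<and> 1 < L \<and>
        (\<forall>\<kappa>\<in>{0..\<kappa>0}. \<forall>n::nat. \<forall>E\<in>{a<..<b}. \<forall>\<epsilon>\<in>{0<..<\<epsilon>0}.
           (\<integral>\<^sup>+ \<omega>. ennreal ((green_norm (fst \<omega>) (snd \<omega>) \<kappa> (Complex E \<epsilon>) n) powr s)
               \<partial>(pot_space nu0 nu sig))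
           \<le> ennreal (C * L powr (- real n))))"
  proof (intro exI conjI ballI allI)
    show "E0 - h / 2 < E0" "E0 < E0 + h / 2" using h by auto
    show "0 < (1 / 2 :: real)" "(1 / 2 :: real) < 1" by auto
    show "0 < h / 2" using h by simp
    show "0 < h" by (rule h)
    show "1 < 1 / l" using l by simp
  qed (rule bound)
qed

end
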